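(* Let $\mathfrak{L}$ be the twisted Heisenberg-Virasoro algebra, let $\alpha\in\mathbb{R}$ with $\alpha>0$ and let $\gamma\in\mathbb{R}$. Let $V$ be an irreducible Harish-Chandra $\mathfrak{L}$-module of the intermediate series that is unitary with respect to the conjugate-linear anti-involution $\theta^{+}_{\alpha,\gamma}$. Then $V$ is isomorphic to $\mathcal{A}_{a,b,c}$ for some $a\in\mathbb{R}$, $b\in\frac12+\sqrt{-1}\,\mathbb{R}$ and $c\in\mathbb{C}$ satisfying $c=\overline{c}\,e^{-i\gamma}$ (where $i=\sqrt{-1}$).
   Context: The twisted Heisenberg-Virasoro algebra $\mathfrak{L}$ is the complex Lie algebra with basis $\{L_m,I_m,C_L,C_I,C_{LI}\mid m\in\mathbb{Z}\}$ and brackets $$[L_m,L_n]=(n-m)L_{m+n}+\delta_{m+n,0}\tfrac{m^3-m}{12}C_L,\quad [I_m,I_n]=n\,\delta_{m+n,0}C_I,$$ $$[L_m,I_n]=nI_{m+n}+\delta_{m+n,0}(m^2-m)C_{LI},\quad [\mathfrak{L},C_L]=[\mathfrak{L},C_I]=[\mathfrak{L},C_{LI}]=0.$$ Put $\mathfrak{h}=\mathfrak{L}_0=\mathrm{span}_{\mathbb{C}}\{L_0,I_0,C_L,C_I,C_{LI}\}$ and $\mathfrak{L}_n=\mathrm{span}_{\mathbb{C}}\{L_n,I_n\}$ for $n\neq0$. A Harish-Chandra module is an $\mathfrak{L}$-module that is the direct sum of its $\mathfrak{h}$-weight spaces, all of which are finite-dimensional. A module of the intermediate series is an indecomposable $\mathfrak{L}$-module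 with a basis $\{v_m\mid m\in\mathbb{Z}\}$ such that $\mathfrak{L}_mv_n\subseteq\mathbb{C}v_{m+n}$ for all $m,n\in\mathbb{Z}$. For $a,b,c\in\mathbb{C}$, $\mathcal{A}_{a,b,c}$ is the $\mathfrak{L}$-module with basis $\{v_k\mid k\in\mathbb{Z}\}$ on which $C_L,C_I,C_{LI}$ act as zero and $$L_mv_k=(a+k+mb)v_{m+k},\qquad I_mv_k=c\,v_{m+k}\qquad(m,k\in\mathbb{Z}).$$ A conjugate-linear anti-involution of a complex Lie algebra $\mathfrak{g}$ is a conjugate-linear map $\theta:\mathfrak{g}\to\mathfrak{g}$ with $\theta([x,y])=[\theta(y),\theta(x)]$ and $\theta^2=\mathrm{id}$. For $\alpha\in\mathbb{R}\setminus\{0\}$, $\gamma\in\mathbb{R}$, $\theta^{+}_{\alpha,\gamma}$ is the conjugate-linear anti-involution of $\mathfrak{L}$ with $\theta^{+}_{\alpha,\gamma}(L_n)=\alpha^nL_{-n}$ ($n\in\mathbb{Z}$), $\theta^{+}_{\alpha,\gamma}(C_L)=C_L$, $\theta^{+}_{\alpha,\gamma}(I_m)=\alpha^me^{i\gamma}I_{-m}$ ($m\neq0$), $\theta^{+}_{\alpha,\gamma}(I_0)=e^{i\gamma}I_0+2e^{i\gamma}C_{LI}$, $\theta^{+}_{\alpha,\gamma}(C_I)=e^{2i\gamma}C_I$, $\theta^{+}_{\alpha,\gamma}(C_{LI})=-e^{i\gamma}C_{LI}$. A $\mathfrak{g}$-module $V$ is unitary with respect to $\theta$ if there is a positive definite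 Hermitian form $\langle\cdot,\cdot\rangle$ on $V$ (linear in the first variable, conjugate-linear in the second) such that $\langle xu,v\rangle=\langle u,\theta(x)v\rangle$ for all $u,v\in V$, $x\in\mathfrak{g}$. *)

theory Defs
  imports Complex_Main "HOL-Library.Poly_Mapping" "HOL-Library.FuncSet"
begin

section \<open>Complex Lie algebras and their modules\<close>

locale complex_lie_algebra = vector_space sg
  for sg :: "complex \<Rightarrow> 'g::ab_group_add \<Rightarrow> 'g" +
  fixes br :: "'g \<Rightarrow> 'g \<Rightarrow> 'g"
  assumes br_linear_left: "Vector_Spaces.linear sg sg (\<lambda>x. br x y)"
    and br_linear_right: "Vector_Spaces.linear sg sg (br x)"
    and br_self: "br x x = 0"
    and jacobi: "br x (br y z) + br y (br z x) + br z (br x y) = 0"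

locale lie_module = complex_lie_algebra sg br + V: vector_space sv
  for sg :: "complex \<Rightarrow> 'g::ab_group_add \<Rightarrow> 'g"
    and br :: "'g \<Rightarrow> 'g \<Rightarrow> 'g"
    and sv :: "complex \<Rightarrow> 'v::ab_group_add \<Rightarrow> 'v" +
  fixes act :: "'g \<Rightarrow> 'v \<Rightarrow> 'v"
  assumes act_linear_left: "Vector_Spaces.linear sg sv (\<lambda>x. act x v)"
    and act_linear_right: "Vector_Spaces.linear sv sv (act x)"
    and act_br: "act (br x y) v = act x (act y v) - act y (act x v)"

text \<open>A module is given by its scalar multiplication \<open>sv\<close> and the action \<open>act\<close> on a whole type.\<close>

definition submodule ::
    "(complex \<Rightarrow> 'v::ab_group_add \<Rightarrow> 'v) \<Rightarrow> ('g \<Rightarrow> 'v \<Rightarrow> 'v) \<Rightarrow> 'v set \<Rightarrow> bool" where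
  "submodule sv act W \<longleftrightarrow> module.subspace sv W \<and> (\<forall>x. \<forall>w\<in>W. act x w \<in> W)"

definition irreducible_module ::
    "(complex \<Rightarrow> 'v::ab_group_add \<Rightarrow> 'v) \<Rightarrow> ('g \<Rightarrow> 'v \<Rightarrow> 'v) \<Rightarrow> bool" where
  "irreducible_module sv act \<longleftrightarrow>
     (UNIV :: 'v set) \<noteq> {0} \<and> (\<forall>W. submodule sv act W \<longrightarrow> W = {0} \<or> W = UNIV)"

definition indecomposable_module ::
    "(complex \<Rightarrow> 'v::ab_group_add \<Rightarrow> 'v) \<Rightarrow> ('g \<Rightarrow> 'v \<Rightarrow> 'v) \<Rightarrow> bool" where
  "indecomposable_module sv act \<longleftrightarrow>
     (UNIV :: 'v set) \<noteq> {0} \<and>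
     \<not> (\<exists>W1 W2. submodule sv act W1 \<and> submodule sv act W2 \<and> W1 \<noteq> {0} \<and> W2 \<noteq> {0} \<and>
          W1 \<inter> W2 = {0} \<and> {w1 + w2 | w1 w2. w1 \<in> W1 \<and> w2 \<in> W2} = UNIV)"

definition isomorphic_modules ::
    "(complex \<Rightarrow> 'v::ab_group_add \<Rightarrow> 'v) \<Rightarrow> ('g \<Rightarrow> 'v \<Rightarrow> 'v) \<Rightarrow>
     (complex \<Rightarrow> 'w::ab_group_add \<Rightarrow> 'w) \<Rightarrow> ('g \<Rightarrow> 'w \<Rightarrow> 'w) \<Rightarrow> bool" where
  "isomorphic_modules sv act sw act' \<longleftrightarrow>
     (\<exists>f. Vector_Spaces.linear sv sw f \<and> bij f \<and> (\<forall>x v. f (act x v) = act' x (f v)))"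

text \<open>The elements of the dual of a subspace \<open>h\<close> are the linear functionals on \<open>h\<close>, extended by
  \<open>undefined\<close> outside \<open>h\<close>, so that distinct indices are distinct functionals on \<open>h\<close>.\<close>

definition dual_of ::
    "(complex \<Rightarrow> 'g::ab_group_add \<Rightarrow> 'g) \<Rightarrow> 'g set \<Rightarrow> ('g \<Rightarrow> complex) set" where
  "dual_of sg h = {l \<in> extensional h.
     (\<forall>x\<in>h. \<forall>y\<in>h. l (x + y) = l x + l y) \<and> (\<forall>k. \<forall>x\<in>h. l (sg k x) = k * l x)}"

definition weight_space ::
    "'g set \<Rightarrow> (complex \<Rightarrow> 'v::ab_group_add \<Rightarrow> 'v) \<Rightarrow> ('g \<Rightarrow> 'v \<Rightarrow> 'v) \<Rightarrow> ('g \<Rightarrow> complex) \<Rightarrow> 'v set"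
  where "weight_space h sv act l = {v. \<forall>x\<in>h. act x v = sv (l x) v}"

definition is_direct_sum :: "'i set \<Rightarrow> ('i \<Rightarrow> 'v::ab_group_add set) \<Rightarrow> bool" where
  "is_direct_sum J W \<longleftrightarrow>
     (\<forall>v. \<exists>!u. (\<forall>j\<in>J. u j \<in> W j) \<and> (\<forall>j. j \<notin> J \<longrightarrow> u j = 0) \<and> finite {j. u j \<noteq> 0} \<and>
          v = (\<Sum>j\<in>{j. u j \<noteq> 0}. u j))"

definition harish_chandra_module ::
    "(complex \<Rightarrow> 'g::ab_group_add \<Rightarrow> 'g) \<Rightarrow> 'g set \<Rightarrow>
     (complex \<Rightarrow> 'v::ab_group_add \<Rightarrow> 'v) \<Rightarrow> ('g \<Rightarrow> 'v \<Rightarrow> 'v) \<Rightarrow> bool" where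
  "harish_chandra_module sg h sv act \<longleftrightarrow>
     is_direct_sum (dual_of sg h) (weight_space h sv act) \<and>
     (\<forall>l\<in>dual_of sg h. \<exists>B. finite B \<and> module.span sv B = weight_space h sv act l)"

definition conj_linear_anti_involution ::
    "(complex \<Rightarrow> 'g::ab_group_add \<Rightarrow> 'g) \<Rightarrow> ('g \<Rightarrow> 'g \<Rightarrow> 'g) \<Rightarrow> ('g \<Rightarrow> 'g) \<Rightarrow> bool" where
  "conj_linear_anti_involution sg br \<theta> \<longleftrightarrow>
     (\<forall>x y. \<theta> (x + y) = \<theta> x + \<theta> y) \<and> (\<forall>k x. \<theta> (sg k x) = sg (cnj k) (\<theta> x)) \<and>
     (\<forall>x y. \<theta> (br x y) = br (\<theta> y) (\<theta> x)) \<and> (\<forall>x. \<theta> (\<theta> x) = x)"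

definition pos_def_hermitian_form ::
    "(complex \<Rightarrow> 'v::ab_group_add \<Rightarrow> 'v) \<Rightarrow> ('v \<Rightarrow> 'v \<Rightarrow> complex) \<Rightarrow> bool" where
  "pos_def_hermitian_form sv H \<longleftrightarrow>
     (\<forall>v. Vector_Spaces.linear sv (*) (\<lambda>u. H u v)) \<and>
     (\<forall>u v. H u v = cnj (H v u)) \<and>
     (\<forall>v. v \<noteq> 0 \<longrightarrow> H v v \<in> \<real> \<and> 0 < Re (H v v))"

definition unitary_module ::
    "('g \<Rightarrow> 'g) \<Rightarrow> (complex \<Rightarrow> 'v::ab_group_add \<Rightarrow> 'v) \<Rightarrow> ('g \<Rightarrow> 'v \<Rightarrow> 'v) \<Rightarrow> bool" where
  "unitary_module \<theta> sv act \<longleftrightarrow>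
     (\<exists>H. pos_def_hermitian_form sv H \<and> (\<forall>x u v. H (act x u) v = H u (act (\<theta> x) v)))"


section \<open>The complex vector space with a given basis\<close>

text \<open>Finitely supported functions \<open>'i \<Rightarrow>\<^sub>0 complex\<close> form the vector space with basis
  \<open>b_elt i\<close>.\<close>

abbreviation b_elt :: "'i \<Rightarrow> ('i \<Rightarrow>\<^sub>0 complex)" where
  "b_elt i \<equiv> Poly_Mapping.single i 1"

definition fscale :: "complex \<Rightarrow> ('i \<Rightarrow>\<^sub>0 complex) \<Rightarrow> ('i \<Rightarrow>\<^sub>0 complex)" where
  "fscale k = Poly_Mapping.map ((*) k)"

definition lin_ext :: "('i \<Rightarrow> 'j \<Rightarrow>\<^sub>0 complex) \<Rightarrow> ('i \<Rightarrow>\<^sub>0 complex) \<Rightarrow> ('j \<Rightarrow>\<^sub>0 complex)" where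
  "lin_ext f x = (\<Sum>i\<in>Poly_Mapping.keys x. fscale (Poly_Mapping.lookup x i) (f i))"

definition conj_lin_ext :: "('i \<Rightarrow> 'j \<Rightarrow>\<^sub>0 complex) \<Rightarrow> ('i \<Rightarrow>\<^sub>0 complex) \<Rightarrow> ('j \<Rightarrow>\<^sub>0 complex)" where
  "conj_lin_ext f x = (\<Sum>i\<in>Poly_Mapping.keys x. fscale (cnj (Poly_Mapping.lookup x i)) (f i))"

definition bilin_ext ::
    "('i \<Rightarrow> 'j \<Rightarrow> 'k \<Rightarrow>\<^sub>0 complex) \<Rightarrow> ('i \<Rightarrow>\<^sub>0 complex) \<Rightarrow> ('j \<Rightarrow>\<^sub>0 complex) \<Rightarrow> ('k \<Rightarrow>\<^sub>0 complex)"
  where "bilin_ext f x y = lin_ext (\<lambda>i. lin_ext (f i) y) x"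

lemma lookup_fscale [simp]: "Poly_Mapping.lookup (fscale k x) i = k * Poly_Mapping.lookup x i"
  by (simp add: fscale_def map.rep_eq when_def)

lemma vector_space_fscale: "vector_space fscale"
  by unfold_locales (auto intro!: poly_mapping_eqI simp: lookup_add algebra_simps)

interpretation fs: vector_space fscale
  by (rule vector_space_fscale)

lemma fscale_single: "fscale k (Poly_Mapping.single i c) = Poly_Mapping.single i (k * c)"
  by (rule poly_mapping_eqI) (simp add: lookup_single when_def)

lemma ext_superset:
  assumes "finite S" "Poly_Mapping.keys x \<subseteq> S" "g 0 = 0"
  shows "(\<Sum>i\<in>Poly_Mapping.keys x. fscale (g (Poly_Mapping.lookup x i)) (f i)) =
         (\<Sum>i\<in>S. fscale (g (Poly_Mapping.lookup x i)) (f i))"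
  by (rule sum.mono_neutral_left) (use assms in \<open>auto simp: in_keys_iff\<close>)

lemma ext_add:
  assumes "g 0 = (0::complex)" "\<And>a b. g (a + b) = g a + g b"
  shows "(\<Sum>i\<in>Poly_Mapping.keys (x + y). fscale (g (Poly_Mapping.lookup (x + y) i)) (f i)) =
         (\<Sum>i\<in>Poly_Mapping.keys x. fscale (g (Poly_Mapping.lookup x i)) (f i)) +
         (\<Sum>i\<in>Poly_Mapping.keys y. fscale (g (Poly_Mapping.lookup y i)) (f i))"
proof -
  let ?S = "Poly_Mapping.keys x \<union> Poly_Mapping.keys y"
  have "Poly_Mapping.keys (x + y) \<subseteq> ?S"
    by (rule Poly_Mapping.keys_add)
  then show ?thesis
    using assms
    by (subst (1 2 3) ext_superset[of ?S])
       (auto simp: lookup_add fs.scale_left_distrib sum.distrib)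
qed

lemma ext_scale:
  assumes "g 0 = (0::complex)" "\<And>a b. g (a * b) = g a * g b"
  shows "(\<Sum>i\<in>Poly_Mapping.keys (fscale k x). fscale (g (Poly_Mapping.lookup (fscale k x) i)) (f i))
         = fscale (g k) (\<Sum>i\<in>Poly_Mapping.keys x. fscale (g (Poly_Mapping.lookup x i)) (f i))"
proof -
  have "Poly_Mapping.keys (fscale k x) \<subseteq> Poly_Mapping.keys x"
    by (auto simp: in_keys_iff)
  then show ?thesis
    using assms
    by (subst ext_superset[of "Poly_Mapping.keys x" "fscale k x"])
       (auto simp: fs.scale_sum_right)
qed

lemma lin_ext_add: "lin_ext f (x + y) = lin_ext f x + lin_ext f y"
  unfolding lin_ext_def using ext_add[of "\<lambda>a. a"] by simp

lemma lin_ext_scale: "lin_ext f (fscale k x) = fscale k (lin_ext f x)"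
  unfolding lin_ext_def using ext_scale[of "\<lambda>a. a"] by simp

lemma conj_lin_ext_add: "conj_lin_ext f (x + y) = conj_lin_ext f x + conj_lin_ext f y"
  unfolding conj_lin_ext_def using ext_add[of cnj] by simp

lemma conj_lin_ext_scale: "conj_lin_ext f (fscale k x) = fscale (cnj k) (conj_lin_ext f x)"
  unfolding conj_lin_ext_def using ext_scale[of cnj] by simp

lemma lin_ext_0 [simp]: "lin_ext f 0 = 0" and conj_lin_ext_0 [simp]: "conj_lin_ext f 0 = 0"
  by (simp_all add: lin_ext_def conj_lin_ext_def)

lemma lin_ext_single [simp]: "lin_ext f (Poly_Mapping.single i c) = fscale c (f i)"
  by (cases "c = 0") (auto simp: lin_ext_def)

lemma conj_lin_ext_single [simp]:
  "conj_lin_ext f (Poly_Mapping.single i c) = fscale (cnj c) (f i)"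
  by (cases "c = 0") (auto simp: conj_lin_ext_def)

lemma bilin_ext_single [simp]:
  "bilin_ext f (Poly_Mapping.single i c) (Poly_Mapping.single j d) = fscale c (fscale d (f i j))"
  by (simp add: bilin_ext_def)

lemma bilin_ext_add_left: "bilin_ext f (x + x') y = bilin_ext f x y + bilin_ext f x' y"
  and bilin_ext_scale_left: "bilin_ext f (fscale k x) y = fscale k (bilin_ext f x y)"
  by (simp_all add: bilin_ext_def lin_ext_add lin_ext_scale)

lemma bilin_ext_add_right: "bilin_ext f x (y + y') = bilin_ext f x y + bilin_ext f x y'"
  by (simp add: bilin_ext_def lin_ext_add lin_ext_def[of _ x] fs.scale_right_distrib sum.distrib)

lemma bilin_ext_scale_right: "bilin_ext f x (fscale k y) = fscale k (bilin_ext f x y)"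
  by (simp add: bilin_ext_def lin_ext_scale lin_ext_def[of _ x] fs.scale_sum_right mult.commute)

lemma bilin_ext_0 [simp]: "bilin_ext f 0 y = 0" "bilin_ext f x 0 = 0"
  by (simp_all add: bilin_ext_def) (simp add: lin_ext_def)

lemmas ext_linear = lin_ext_add lin_ext_scale conj_lin_ext_add conj_lin_ext_scale
  bilin_ext_add_left bilin_ext_scale_left bilin_ext_add_right bilin_ext_scale_right

lemma basis_induct [case_names zero single add]:
  fixes x :: "'i \<Rightarrow>\<^sub>0 complex"
  assumes "P 0" "\<And>i. P (b_elt i)" "\<And>k x y. P x \<Longrightarrow> P y \<Longrightarrow> P (fscale k x + y)"
  shows "P x"
proof -
  have "P (\<Sum>i\<in>S. fscale (c i) (b_elt i))" if "finite S" for S and c :: "'i \<Rightarrow> complex"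
    using that by (induction S rule: finite_induct) (use assms in auto)
  moreover have "x = (\<Sum>i\<in>Poly_Mapping.keys x. fscale (Poly_Mapping.lookup x i) (b_elt i))"
    by (rule poly_mapping_eqI)
       (auto simp: lookup_sum lookup_single when_def if_distrib in_keys_iff cong: if_cong)
  ultimately show ?thesis
    by (metis finite_keys)
qed


section \<open>The twisted Heisenberg-Virasoro algebra\<close>

datatype hv_basis = Lb int | Ib int | C_L | C_I | C_LI

type_synonym hv = "hv_basis \<Rightarrow>\<^sub>0 complex"

text \<open>The third equation is \<open>[I\<^sub>m, L\<^sub>n] = - [L\<^sub>n, I\<^sub>m]\<close>.\<close>

fun hv_br_basis :: "hv_basis \<Rightarrow> hv_basis \<Rightarrow> hv" where
  "hv_br_basis (Lb m) (Lb n) = fscale (of_int (n - m)) (b_elt (Lb (m + n))) +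
     (if m + n = 0 then fscale ((of_int m ^ 3 - of_int m) / 12) (b_elt C_L) else 0)"
| "hv_br_basis (Lb m) (Ib n) = fscale (of_int n) (b_elt (Ib (m + n))) +
     (if m + n = 0 then fscale (of_int m ^ 2 - of_int m) (b_elt C_LI) else 0)"
| "hv_br_basis (Ib m) (Lb n) = - (fscale (of_int m) (b_elt (Ib (n + m))) +
     (if n + m = 0 then fscale (of_int n ^ 2 - of_int n) (b_elt C_LI) else 0))"
| "hv_br_basis (Ib m) (Ib n) = (if m + n = 0 then fscale (of_int n) (b_elt C_I) else 0)"
| "hv_br_basis _ _ = 0"

definition hv_br :: "hv \<Rightarrow> hv \<Rightarrow> hv" where
  "hv_br = bilin_ext hv_br_basis"

definition hv_cartan :: "hv set" where
  "hv_cartan =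
     module.span fscale {b_elt (Lb 0), b_elt (Ib 0), b_elt C_L, b_elt C_I, b_elt C_LI}"

definition hv_graded :: "int \<Rightarrow> hv set" where
  "hv_graded n =
     (if n = 0 then hv_cartan else module.span fscale {b_elt (Lb n), b_elt (Ib n)})"

definition intermediate_series ::
    "(complex \<Rightarrow> 'v::ab_group_add \<Rightarrow> 'v) \<Rightarrow> (hv \<Rightarrow> 'v \<Rightarrow> 'v) \<Rightarrow> bool" where
  "intermediate_series sv act \<longleftrightarrow>
     indecomposable_module sv act \<and>
     (\<exists>v :: int \<Rightarrow> 'v. inj v \<and> \<not> module.dependent sv (range v) \<and>
        module.span sv (range v) = UNIV \<and>
        (\<forall>m n. \<forall>x\<in>hv_graded m. act x (v n) \<in> module.span sv {v (m + n)}))"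

fun A_act_basis :: "complex \<Rightarrow> complex \<Rightarrow> complex \<Rightarrow> hv_basis \<Rightarrow> int \<Rightarrow> (int \<Rightarrow>\<^sub>0 complex)" where
  "A_act_basis a b c (Lb m) k = fscale (a + of_int k + of_int m * b) (b_elt (m + k))"
| "A_act_basis a b c (Ib m) k = fscale c (b_elt (m + k))"
| "A_act_basis a b c _ k = 0"

definition A_act :: "complex \<Rightarrow> complex \<Rightarrow> complex \<Rightarrow> hv \<Rightarrow> (int \<Rightarrow>\<^sub>0 complex) \<Rightarrow> (int \<Rightarrow>\<^sub>0 complex)" where
  "A_act a b c = bilin_ext (A_act_basis a b c)"

fun theta_plus_basis :: "real \<Rightarrow> real \<Rightarrow> hv_basis \<Rightarrow> hv" where
  "theta_plus_basis \<alpha> \<gamma> (Lb n) = fscale (of_real \<alpha> powi n) (b_elt (Lb (- n)))"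
| "theta_plus_basis \<alpha> \<gamma> (Ib m) =
     (if m = 0
      then fscale (exp (\<i> * of_real \<gamma>)) (b_elt (Ib 0)) +
           fscale (2 * exp (\<i> * of_real \<gamma>)) (b_elt C_LI)
      else fscale (of_real \<alpha> powi m * exp (\<i> * of_real \<gamma>)) (b_elt (Ib (- m))))"
| "theta_plus_basis \<alpha> \<gamma> C_L = b_elt C_L"
| "theta_plus_basis \<alpha> \<gamma> C_I = fscale (exp (2 * \<i> * of_real \<gamma>)) (b_elt C_I)"
| "theta_plus_basis \<alpha> \<gamma> C_LI = - fscale (exp (\<i> * of_real \<gamma>)) (b_elt C_LI)"

definition theta_plus :: "real \<Rightarrow> real \<Rightarrow> hv \<Rightarrow> hv" where
  "theta_plus \<alpha> \<gamma> = conj_lin_ext (theta_plus_basis \<alpha> \<gamma>)"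


subsection \<open>Well-definedness\<close>

lemma linear_fscaleI:
  assumes "\<And>x y. f (x + y) = f x + f y" "\<And>k x. f (fscale k x) = fscale k (f x)"
  shows "Vector_Spaces.linear fscale fscale f"
  using assms by unfold_locales

lemma hv_br_skew: "hv_br x y = - hv_br y x"
proof -
  have basis: "hv_br_basis i j = - hv_br_basis j i" for i j
  proof (cases i; cases j)
    fix m n assume ij: "i = Lb m" "j = Lb n"
    show ?thesis
    proof (cases "n = - m")
      case True
      show ?thesis unfolding ij True
        by (rule poly_mapping_eqI)
           (simp add: lookup_add lookup_minus lookup_single when_def field_simps power3_eq_cube)
    next
      case False
      then have "n + m \<noteq> 0" "m + n \<noteq> 0" by simp_all
      then show ?thesis unfolding ij
        by (intro poly_mapping_eqI)
           (simp add: lookup_single when_def add.commute[of n m] algebra_simps)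
    qed
  next
    fix m n assume ij: "i = Ib m" "j = Ib n"
    show ?thesis
    proof (cases "n = - m")
      case True
      show ?thesis unfolding ij True
        by (rule poly_mapping_eqI) (simp add: lookup_single when_def)
    next
      case False
      then have "n + m \<noteq> 0" "m + n \<noteq> 0" by simp_all
      then show ?thesis unfolding ij by simp
    qed
  qed simp_all
  show ?thesis
  proof (induction x rule: basis_induct)
    case zero
    show ?case by (simp add: hv_br_def)
  next
    case (single i)
    show ?case
    proof (induction y rule: basis_induct)
      case (single j)
      then show ?case using basis[of i j] by (simp add: hv_br_def)
    qed (simp_all add: hv_br_def ext_linear)
  next
    case (add k x y')
    then show ?case by (simp add: hv_br_def ext_linear)
  qed
qed

lemma bilin_ext_minus [simp]:
  "bilin_ext f (- x) y = - bilin_ext f x y" "bilin_ext f x (- y) = - bilin_ext f x y"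
  using bilin_ext_scale_left[of f "-1" x y] bilin_ext_scale_right[of f x "-1" y] by simp_all

lemma hv_br_central:
  assumes "k \<in> {C_L, C_I, C_LI}"
  shows "hv_br x (b_elt k) = 0" "hv_br (b_elt k) x = 0"
proof -
  show "hv_br x (b_elt k) = 0"
  proof (induction x rule: basis_induct)
    case (single i)
    then show ?case using assms by (cases i) (auto simp: hv_br_def)
  qed (simp_all add: hv_br_def ext_linear)
  then show "hv_br (b_elt k) x = 0"
    using hv_br_skew[of "b_elt k" x] by simp
qed

lemma hv_br_linear:
  "hv_br (x + x') y = hv_br x y + hv_br x' y" "hv_br (fscale k x) y = fscale k (hv_br x y)"
  "hv_br x (y + y') = hv_br x y + hv_br x y'" "hv_br x (fscale k y) = fscale k (hv_br x y)"
  "hv_br x (- y) = - hv_br x y" "hv_br (- x) y = - hv_br x y" "hv_br x (y - y') = hv_br x y - hv_br x y'" "hv_br 0 y = 0" "hv_br x 0 = 0"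
  using bilin_ext_add_right[of hv_br_basis x y "- y'"]
  by (simp_all add: hv_br_def ext_linear)

lemma hv_br_basis_eq: "hv_br (b_elt i) (b_elt j) = hv_br_basis i j"
  by (simp add: hv_br_def)

lemma hv_jacobi: "hv_br x (hv_br y z) + hv_br y (hv_br z x) + hv_br z (hv_br x y) = 0"
proof -
  define J where "J x y z = hv_br x (hv_br y z) + hv_br y (hv_br z x) + hv_br z (hv_br x y)" for x y z
  have J_cyc: "J x y z = J y z x" for x y z
    by (simp add: J_def add.commute add.left_commute)
  have J_lin: "J (fscale k x + x') y z = fscale k (J x y z) + J x' y z" for k x x' y z
    by (simp add: J_def hv_br_linear fs.scale_right_distrib algebra_simps)
  have J_0: "J 0 y z = 0" for y z
    by (simp add: J_def hv_br_linear)
  have LL: "hv_br x (hv_br (b_elt (Lb n)) (b_elt (Lb k))) =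
      fscale (of_int (k - n)) (hv_br x (b_elt (Lb (n + k))))"
    and LI: "hv_br x (hv_br (b_elt (Lb n)) (b_elt (Ib k))) =
      fscale (of_int k) (hv_br x (b_elt (Ib (n + k))))"
    and IL: "hv_br x (hv_br (b_elt (Ib n)) (b_elt (Lb k))) =
      - fscale (of_int n) (hv_br x (b_elt (Ib (k + n))))"
    and II: "hv_br x (hv_br (b_elt (Ib n)) (b_elt (Ib k))) = 0" for x n k
    by (simp_all add: hv_br_basis_eq hv_br_linear hv_br_central)
  have LLL: "J (b_elt (Lb m)) (b_elt (Lb n)) (b_elt (Lb k)) = 0" for m n k
  proof (cases "m + n + k = 0")
    case True
    then have k: "k = - m - n" by simp
    show ?thesis
      unfolding J_def LL unfolding hv_br_basis_eq k
      by (rule poly_mapping_eqI)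
         (simp add: lookup_add lookup_minus lookup_single when_def, simp add: field_simps power3_eq_cube)
  next
    case False
    then have "m + (n + k) \<noteq> 0" "n + (k + m) \<noteq> 0" "k + (m + n) \<noteq> 0" by simp_all
    then show ?thesis
      unfolding J_def LL unfolding hv_br_basis_eq
      by (intro poly_mapping_eqI) (simp add: lookup_add lookup_minus lookup_single when_def algebra_simps)
  qed
  have LLI: "J (b_elt (Lb m)) (b_elt (Lb n)) (b_elt (Ib k)) = 0" for m n k
  proof (cases "m + n + k = 0")
    case True
    then have k: "k = - m - n" by simp
    show ?thesis
      unfolding J_def LL LI IL unfolding hv_br_basis_eq k
      by (rule poly_mapping_eqI)
         (simp add: lookup_add lookup_minus lookup_single when_def, simp add: algebra_simps power2_eq_square)
  next
    case False
    then have "m + (n + k) \<noteq> 0" "n + (k + m) \<noteq> 0" "n + (m + k) \<noteq> 0" "m + n + k \<noteq> 0" by simp_all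
    then show ?thesis
      unfolding J_def LL LI IL unfolding hv_br_basis_eq
      by (intro poly_mapping_eqI) (simp add: lookup_add lookup_minus lookup_single when_def algebra_simps)
  qed
  have LII: "J (b_elt (Lb m)) (b_elt (Ib n)) (b_elt (Ib k)) = 0" for m n k
  proof (cases "m + n + k = 0")
    case True
    then have k: "k = - m - n" by simp
    show ?thesis
      unfolding J_def LI IL II k unfolding hv_br_basis_eq
      by (rule poly_mapping_eqI)
         (simp add: lookup_add lookup_minus lookup_single when_def, simp add: algebra_simps)
  next
    case False
    then have "n + (m + k) \<noteq> 0" "k + (m + n) \<noteq> 0" "m + n + k \<noteq> 0" by simp_all
    then show ?thesis
      unfolding J_def LI IL II unfolding hv_br_basis_eq
      by (intro poly_mapping_eqI) (simp add: lookup_add lookup_minus lookup_single when_def algebra_simps)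
  qed
  have III: "J (b_elt (Ib m)) (b_elt (Ib n)) (b_elt (Ib k)) = 0" for m n k
    by (simp add: J_def II)
  have LIL: "J (b_elt (Lb m)) (b_elt (Ib n)) (b_elt (Lb k)) = 0" for m n k
    by (subst J_cyc, subst J_cyc) (rule LLI)
  have ILL: "J (b_elt (Ib m)) (b_elt (Lb n)) (b_elt (Lb k)) = 0" for m n k
    by (subst J_cyc) (rule LLI)
  have IIL: "J (b_elt (Ib m)) (b_elt (Ib n)) (b_elt (Lb k)) = 0" for m n k
    by (subst J_cyc, subst J_cyc) (rule LII)
  have ILI: "J (b_elt (Ib m)) (b_elt (Lb n)) (b_elt (Ib k)) = 0" for m n k
    by (subst J_cyc) (rule LII)
  have central: "J (b_elt i) (b_elt j) (b_elt k) = 0" if "k \<in> {C_L, C_I, C_LI}" for i j k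
    using that by (simp add: J_def hv_br_central hv_br_linear)
  have basis: "J (b_elt i) (b_elt j) (b_elt k) = 0" for i j k
  proof (cases "{i, j, k} \<inter> {C_L, C_I, C_LI} = {}")
    case False
    then have "i \<in> {C_L, C_I, C_LI} \<or> j \<in> {C_L, C_I, C_LI} \<or> k \<in> {C_L, C_I, C_LI}" by blast
    then show ?thesis
      using central[of k i j] central[of i j k] central[of j k i]
        J_cyc[of "b_elt i" "b_elt j" "b_elt k"] J_cyc[of "b_elt j" "b_elt k" "b_elt i"]
      by metis
  next
    case True
    then show ?thesis
      by (cases i; cases j; cases k) (simp_all add: LLL LLI LII III LIL ILL IIL ILI)
  qed
  have J_step: "J x y z = 0" if "\<And>i. J (b_elt i) y z = 0" for x y z
    by (induction x rule: basis_induct) (simp_all add: J_0 J_lin that)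
  have 1: "J x (b_elt j) (b_elt k) = 0" for x j k
    by (rule J_step) (rule basis)
  have 2: "J x y (b_elt k) = 0" for x y k
    by (subst J_cyc, rule J_step, subst J_cyc, subst J_cyc, rule 1)
  have "J x y z = 0"
    by (subst J_cyc, subst J_cyc, rule J_step, subst J_cyc, rule 2)
  then show ?thesis
    by (simp add: J_def)
qed

lemma complex_lie_algebra_hv: "complex_lie_algebra fscale hv_br"
proof
  show "hv_br x x = 0" for x
  proof (rule poly_mapping_eqI)
    fix k
    show "Poly_Mapping.lookup (hv_br x x) k = Poly_Mapping.lookup 0 k"
      using arg_cong[OF hv_br_skew[of x x], of "\<lambda>z. Poly_Mapping.lookup z k"] by simp
  qed
qed (auto simp: hv_br_linear hv_jacobi)

lemma conj_linear_anti_involution_theta_plus: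
  assumes "\<alpha> \<noteq> 0"
  shows "conj_linear_anti_involution fscale hv_br (theta_plus \<alpha> \<gamma>)"
proof -
  let ?e = "exp (\<i> * of_real \<gamma>) :: complex" and ?t = "theta_plus \<alpha> \<gamma>"
  define p where "p n = (of_real (\<alpha> powi n) :: complex)" for n
  have e1: "?e * cnj ?e = 1" and e2: "exp (2 * \<i> * of_real \<gamma>) = ?e * ?e"
    by (simp_all add: mult.assoc cis_cnj cis_mult flip: cis_conv_exp)
       (simp add: cis_conv_exp mult_ac flip: exp_add)
  define e where "e = ?e"
  have "e * cnj e = 1"
    using e1 by (simp add: e_def)
  then have e: "e * cnj e = 1" "cnj e * e = 1" "cnj e * (e * x) = x" "e * (cnj e * x) = x" for x
    by (metis mult.assoc mult.commute mult_1)+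
  have lin: "?t (x + y) = ?t x + ?t y" "?t (fscale k x) = fscale (cnj k) (?t x)"
    "?t 0 = 0" for x y k
    by (simp_all add: theta_plus_def ext_linear)
  have min: "?t (- x) = - ?t x" for x
    using lin(2)[of "-1" x] by simp
  have dif: "?t (x - y) = ?t x - ?t y" for x y
    using lin(1)[of x "- y"] by (simp add: min)
  have p: "cnj (p n) = p n" "p 0 = 1" "p (m + n) = p m * p n" for m n
    using assms by (simp_all add: p_def power_int_add)
  have p_inv: "p m * p (- m) = 1" "p (- m) * p m = 1" for m
    using p(2) p(3)[of m "- m"] by (simp_all add: mult.commute)
  have bas: "?t (b_elt (Lb n)) = fscale (p n) (b_elt (Lb (- n)))"
    "?t (b_elt (Ib m)) = fscale (p m * e) (b_elt (Ib (- m))) +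
       (if m = 0 then fscale (2 * e) (b_elt C_LI) else 0)"
    "?t (b_elt C_L) = b_elt C_L" "?t (b_elt C_I) = fscale (e * e) (b_elt C_I)"
    "?t (b_elt C_LI) = fscale (- e) (b_elt C_LI)" for n m
    by (simp_all add: theta_plus_def p_def e_def e2)
  have inv: "?t (?t (b_elt i)) = b_elt i" for i
    by (cases i; rule poly_mapping_eqI)
       (auto simp: bas lin min dif p p_inv e lookup_add algebra_simps simp flip: mult.assoc)
  have sw: "- n - m = - m - n" for m n :: int
    by simp
  have LL: "?t (hv_br (b_elt (Lb m)) (b_elt (Lb n))) = hv_br (?t (b_elt (Lb n))) (?t (b_elt (Lb m)))"
    for m n
  proof (cases "m + n = 0")
    case True
    then have n: "n = - m" by simp
    show ?thesis
      unfolding n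
      by (cases "m = 0"; rule poly_mapping_eqI)
         (simp_all add: bas lin min dif hv_br_linear hv_br_basis_eq hv_br_central p
           lookup_add lookup_minus lookup_single when_def,
          simp_all add: p_inv flip: mult.assoc, (simp_all add: algebra_simps)?)
  next
    case False
    then have nz: "m + n \<noteq> 0" "n + m \<noteq> 0" "- m - n \<noteq> 0" "- n - m \<noteq> 0" by simp_all
    show ?thesis
      by (cases "m = 0"; cases "n = 0")
         (use nz in \<open>simp_all add: bas lin min dif hv_br_linear hv_br_basis_eq hv_br_central p sw mult_ac\<close>)
  qed
  have LI: "?t (hv_br (b_elt (Lb m)) (b_elt (Ib n))) = hv_br (?t (b_elt (Ib n))) (?t (b_elt (Lb m)))"
    for m n
  proof (cases "m + n = 0")
    case True
    then have n: "n = - m" by simp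
    show ?thesis
      unfolding n
      by (cases "m = 0"; rule poly_mapping_eqI)
         (simp_all add: bas lin min dif hv_br_linear hv_br_basis_eq hv_br_central p
           lookup_add lookup_minus lookup_single when_def,
          simp_all add: p_inv flip: mult.assoc, (simp_all add: algebra_simps)?)
  next
    case False
    then have nz: "m + n \<noteq> 0" "n + m \<noteq> 0" "- m - n \<noteq> 0" "- n - m \<noteq> 0" by simp_all
    show ?thesis
      by (cases "m = 0"; cases "n = 0")
         (use nz in \<open>simp_all add: bas lin min dif hv_br_linear hv_br_basis_eq hv_br_central p sw mult_ac\<close>)
  qed
  have II: "?t (hv_br (b_elt (Ib m)) (b_elt (Ib n))) = hv_br (?t (b_elt (Ib n))) (?t (b_elt (Ib m)))"
    for m n
  proof (cases "m + n = 0")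
    case True
    then have n: "n = - m" by simp
    show ?thesis
      unfolding n
      by (cases "m = 0"; rule poly_mapping_eqI)
         (simp_all add: bas lin min dif hv_br_linear hv_br_basis_eq hv_br_central p
           lookup_add lookup_minus lookup_single when_def,
          simp_all add: p_inv flip: mult.assoc, (simp_all add: algebra_simps)?)
  next
    case False
    then have nz: "m + n \<noteq> 0" "n + m \<noteq> 0" "- m - n \<noteq> 0" "- n - m \<noteq> 0" by simp_all
    show ?thesis
      by (cases "m = 0"; cases "n = 0")
         (use nz in \<open>simp_all add: bas lin min dif hv_br_linear hv_br_basis_eq hv_br_central p sw mult_ac\<close>)
  qed
  have IL: "?t (hv_br (b_elt (Ib m)) (b_elt (Lb n))) = hv_br (?t (b_elt (Lb n))) (?t (b_elt (Ib m)))" for m n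
    using LI[of n m] hv_br_skew[of "b_elt (Ib m)" "b_elt (Lb n)"]
      hv_br_skew[of "?t (b_elt (Lb n))" "?t (b_elt (Ib m))"]
    by (simp add: min)
  have cen: "?t (hv_br (b_elt i) (b_elt j)) = hv_br (?t (b_elt j)) (?t (b_elt i))"
    if "i \<in> {C_L, C_I, C_LI} \<or> j \<in> {C_L, C_I, C_LI}" for i j
    using that by (auto simp: bas lin hv_br_central hv_br_linear)
  have 3: "?t (hv_br (b_elt i) (b_elt j)) = hv_br (?t (b_elt j)) (?t (b_elt i))" for i j
    by (cases i; cases j) (simp_all add: LL LI IL II cen)
  have 2: "?t (hv_br (b_elt i) y) = hv_br (?t y) (?t (b_elt i))" for i y
    by (induction y rule: basis_induct) (simp_all add: 3 lin hv_br_linear)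
  have "?t (hv_br x y) = hv_br (?t y) (?t x)" for x y
    by (induction x rule: basis_induct) (simp_all add: 2 lin hv_br_linear)
  moreover have "?t (?t x) = x" for x
    by (induction x rule: basis_induct) (simp_all add: inv lin)
  ultimately show ?thesis
    by (simp add: conj_linear_anti_involution_def lin)
qed

lemma lie_module_A: "lie_module fscale hv_br fscale (A_act a b c)"
proof -
  let ?A = "A_act a b c"
  have lin:
    "?A (x + x') y = ?A x y + ?A x' y" "?A (fscale k x) y = fscale k (?A x y)"
    "?A x (y + y') = ?A x y + ?A x y'" "?A x (fscale k y) = fscale k (?A x y)"
    "?A (- x) y = - ?A x y" "?A (x - x') y = ?A x y - ?A x' y" "?A 0 y = 0" "?A x 0 = 0" for x x' y y' k
    using bilin_ext_add_left[of "A_act_basis a b c" x "- x'" y]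
    by (simp_all add: A_act_def ext_linear)
  have bas: "?A (b_elt i) (b_elt k) = A_act_basis a b c i k" for i k
    by (simp add: A_act_def)
  have basis: "?A (hv_br (b_elt i) (b_elt j)) (b_elt k) =
      ?A (b_elt i) (?A (b_elt j) (b_elt k)) - ?A (b_elt j) (?A (b_elt i) (b_elt k))" for i j k
    by (cases i; cases j; rule poly_mapping_eqI)
       (simp_all add: hv_br_basis_eq bas lin lookup_add lookup_minus lookup_single when_def algebra_simps)
  have 2: "?A (hv_br (b_elt i) (b_elt j)) v =
      ?A (b_elt i) (?A (b_elt j) v) - ?A (b_elt j) (?A (b_elt i) v)" for i j v
    by (induction v rule: basis_induct) (simp_all add: basis lin fs.scale_right_diff_distrib)
  have 1: "?A (hv_br (b_elt i) y) v = ?A (b_elt i) (?A y v) - ?A y (?A (b_elt i) v)" for i y v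
    by (induction y rule: basis_induct) (simp_all add: 2 lin hv_br_linear fs.scale_right_diff_distrib)
  have "?A (hv_br x y) v = ?A x (?A y v) - ?A y (?A x v)" for x y v
    by (induction x rule: basis_induct) (simp_all add: 1 lin hv_br_linear fs.scale_right_diff_distrib)
  with complex_lie_algebra_hv show ?thesis
    unfolding lie_module_def lie_module_axioms_def
    by (auto intro!: linear_fscaleI simp: lin vector_space_fscale)
qed

end

theory Submission
  imports Defs "HOL-Computational_Algebra.Polynomial"
begin

text \<open>Let \<open>F m n\<close> and \<open>G m n\<close> be the coefficients of \<open>L\<^sub>m\<close> and \<open>I\<^sub>m\<close> on the \<open>n\<close>-th basis vector.
  Irreducibility makes \<open>L\<^sub>0\<close> act on that vector by \<open>x = a + n\<close> with \<open>a\<close> real by unitarity, and makes the central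
  elements and \<open>I\<^sub>0\<close> scalars; after rescaling the basis, \<open>L\<^sub>-\<^sub>m\<close> has the adjoint coefficients of
  \<open>L\<^sub>m\<close>. The brackets of adjoint pairs then give \<open>\<bar>F 1 n\<bar>\<^sup>2 = x\<^sup>2 + x + p\<close>, a quadratic formula for
  \<open>\<bar>F 2 n\<bar>\<^sup>2\<close> on each parity class, and \<open>[L\<^sub>-\<^sub>1, L\<^sub>2] = 3 L\<^sub>1\<close> makes \<open>F 2 n\<close> times the conjugate of
  \<open>F 1 n * F 1 (n + 1)\<close> a cubic in \<open>x\<close>. Comparing the squared modulus of this cubic with the product of the
  three quadratics forces \<open>C\<^sub>L = 0\<close> and \<open>p\<^sup>2 (4 p - 1) \<ge> 0\<close>; as \<open>p = 0\<close> violates positivity of the two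
  quadratics, \<open>p = 1/4 + t\<^sup>2\<close>, that is \<open>b = 1/2 + \<i> t\<close>. The coefficients are thereby known up to
  phases, which can be gauged away, and the coefficients of \<open>I\<^sub>1\<close> have constant modulus and are pinned
  down in the same fashion.\<close>

section \<open>Recursions and polynomial identities over the integers\<close>

text \<open>A nonzero polynomial has finitely many roots. This turns relations known only at the
  weights \<open>a + n\<close>, or at one parity class of them, into relations between
  coefficients.\<close>

lemma poly_eq_0_on_progression:
  fixes p :: "'a::field_char_0 poly"
  assumes "\<And>k::int. poly p (s + d * of_int k) = 0" and "d \<noteq> 0"
  shows "p = 0"
proof (rule ccontr)
  assume "p \<noteq> 0"
  then have "finite {y. poly p y = 0}"
    by (rule poly_roots_finite)
  moreover have "range (\<lambda>k::int. s + d * of_int k) \<subseteq> {y. poly p y = 0}"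
    using assms(1) by auto
  ultimately have "finite (range (\<lambda>k::int. s + d * of_int k))"
    by (rule finite_subset[rotated])
  moreover have "inj (\<lambda>k::int. s + d * of_int k)"
    using assms(2) by (auto intro!: injI)
  ultimately show False
    using finite_imageD infinite_UNIV_int by blast
qed

lemma int_step_periodic:
  fixes f :: "int \<Rightarrow> 'a"
  assumes "\<And>n. f (n + d) = f n"
  shows "f (n + d * k) = f n"
proof (induction k rule: int_induct[where k = 0])
  case (step1 i)
  then show ?case
    using assms[of "n + d * i"] by (simp add: algebra_simps)
next
  case (step2 i)
  then show ?case
    using assms[of "n + d * (i - 1)"] by (simp add: algebra_simps)
qed simp

text \<open>Difference equations are solved by this: an unknown minus its expected closed form is
  invariant under the shift, and the remaining constant is its value at 0.\<close>

lemma int_step_constant: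
  fixes f :: "int \<Rightarrow> 'a"
  assumes "\<And>n. f (n + 1) = f n"
  shows "f n = f 0"
  using int_step_periodic[of f 1 0 n] assms by simp

text \<open>To the left of 0 the recursion divides by \<open>d\<close>, so every \<open>d n\<close>
  must be nonzero. It is applied to ratios of consecutive phases.\<close>

lemma int_recursion_exists:
  fixes d :: "int \<Rightarrow> 'a::field"
  assumes "\<And>n. d n \<noteq> 0"
  obtains c where "\<And>n. c (n + 1) = d n * c n" "c 0 = 1"
proof -
  define c where
    "c n = (if n \<ge> 0 then (\<Prod>i\<in>{0..<n}. d i) else (\<Prod>i\<in>{n..<0}. inverse (d i)))" for n :: int
  have "c (n + 1) = d n * c n" for n
  proof (cases "n \<ge> 0")
    case True
    then have "{0..<n + 1} = insert n {0..<n}" by auto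
    with True show ?thesis by (simp add: c_def)
  next
    case False
    then have "{n..<0} = insert n {n + 1..<0}" by auto
    with False assms show ?thesis by (auto simp: c_def)
  qed
  moreover have "c 0 = 1" by (simp add: c_def)
  ultimately show thesis by (rule that)
qed

section \<open>Structure coefficients\<close>

text \<open>The scalars \<open>c\<close>, \<open>w\<close>, \<open>z\<close>, \<open>\<kappa>\<close> are the actions of \<open>I\<^sub>0\<close>, \<open>C\<^sub>L\<^sub>I\<close>, \<open>C\<^sub>L\<close>, \<open>C\<^sub>I\<close>.\<close>

locale hv_coeffs =
  fixes F G :: "int \<Rightarrow> int \<Rightarrow> complex" and a c w z \<kappa> :: complex
  assumes LL: "F m (k + n) * F n k - F n (k + m) * F m k = of_int (n - m) * F (m + n) k +
      (if m + n = 0 then (of_int m ^ 3 - of_int m) / 12 * z else 0)"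
    and LI: "F m (k + n) * G n k - G n (k + m) * F m k = of_int n * G (m + n) k +
      (if m + n = 0 then (of_int m ^ 2 - of_int m) * w else 0)"
    and II: "G m (k + n) * G n k - G n (k + m) * G m k = (if m + n = 0 then of_int n * \<kappa> else 0)"
    and L0: "F 0 k = a + of_int k"
    and I0: "G 0 k = c"
begin

text \<open>These are the coefficients in the basis whose \<open>n\<close>-th vector is multiplied
  by \<open>r n\<close>. The factors telescope to \<open>r k / r (k + n + m)\<close>, which is 1
  whenever a central term occurs.\<close>

lemma gauge:
  assumes r: "\<And>n. r n \<noteq> 0"
  shows "hv_coeffs (\<lambda>m n. r n * F m n / r (n + m)) (\<lambda>m n. r n * G m n / r (n + m)) a c w z \<kappa>"
proof
  fix m n k :: int
  have sw: "k + m + n = k + n + m" "k + (m + n) = k + n + m" by simp_all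
  have tr: "r (k + n) * A m (k + n) / r (k + n + m) * (r k * B n k / r (k + n)) -
      r (k + m) * B n (k + m) / r (k + m + n) * (r k * A m k / r (k + m)) =
      r k / r (k + n + m) * (A m (k + n) * B n k - B n (k + m) * A m k)" for A B :: "int \<Rightarrow> int \<Rightarrow> complex"
    using r[of "k + n"] r[of "k + m"] unfolding sw by (simp add: right_diff_distrib mult_ac)
  have del: "r k / r (k + n + m) * (if m + n = 0 then u else 0) = (if m + n = 0 then u else 0)" for u
  proof (cases "m + n = 0")
    case True
    then have km: "k + n + m = k" by simp
    show ?thesis unfolding km using r[of k] by simp
  qed simp
  show "r (k + n) * F m (k + n) / r (k + n + m) * (r k * F n k / r (k + n)) -
       r (k + m) * F n (k + m) / r (k + m + n) * (r k * F m k / r (k + m)) =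
       of_int (n - m) * (r k * F (m + n) k / r (k + (m + n))) +
       (if m + n = 0 then (of_int m ^ 3 - of_int m) / 12 * z else 0)"
    unfolding tr LL distrib_left del by (simp add: sw)
  show "r (k + n) * F m (k + n) / r (k + n + m) * (r k * G n k / r (k + n)) -
       r (k + m) * G n (k + m) / r (k + m + n) * (r k * F m k / r (k + m)) =
       of_int n * (r k * G (m + n) k / r (k + (m + n))) +
       (if m + n = 0 then (of_int m ^ 2 - of_int m) * w else 0)"
    unfolding tr LI distrib_left del by (simp add: sw)
  show "r (k + n) * G m (k + n) / r (k + n + m) * (r k * G n k / r (k + n)) -
       r (k + m) * G n (k + m) / r (k + m + n) * (r k * G m k / r (k + m)) =
       (if m + n = 0 then of_int n * \<kappa> else 0)"
    unfolding tr II distrib_left del by (simp add: sw)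
  show "r k * F 0 k / r (k + 0) = a + of_int k" "r k * G 0 k / r (k + 0) = c"
    using r[of k] by (simp_all add: L0 I0)
qed

end

text \<open>Here \<open>e\<close> stands for \<open>exp (\<i> * \<gamma>)\<close>, and the basis is normalised so that the squared norm of its
  \<open>n\<close>-th vector is \<open>\<alpha>\<close> to the power \<open>n\<close>, which removes \<open>\<alpha>\<close> from the adjointness relations.\<close>

locale unitary_hv_coeffs = hv_coeffs F G "of_real a" c w z \<kappa>
  for F G :: "int \<Rightarrow> int \<Rightarrow> complex" and a :: real and c w z \<kappa> :: complex +
  fixes e :: complex
  assumes F_adj: "F (- m) (n + m) = cnj (F m n)"
    and G_adj: "m \<noteq> 0 \<Longrightarrow> cnj (G m n) = e * G (- m) (n + m)"
    and I0_adj: "cnj c = e * (c + 2 * w)"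
    and e_unit: "cnj e * e = 1"
begin

text \<open>Phases leave the norms of the basis vectors alone: the conjugate of \<open>r n\<close>
  is its inverse, so both sides of each adjointness relation acquire the same factor.\<close>

lemma unitary_gauge:
  assumes r: "\<And>n. cmod (r n) = 1"
  shows "unitary_hv_coeffs (\<lambda>m n. r n * F m n / r (n + m)) (\<lambda>m n. r n * G m n / r (n + m)) a c w z \<kappa> e"
proof -
  have nz: "r n \<noteq> 0" for n using r[of n] by auto
  have cr: "cnj (r n) = inverse (r n)" for n
    using r[of n] by (metis complex_norm_square inverse_unique mult.commute of_real_1 one_power2)
  interpret g: hv_coeffs "\<lambda>m n. r n * F m n / r (n + m)" "\<lambda>m n. r n * G m n / r (n + m)" a c w z \<kappa>
    using gauge nz by blast
  show ?thesis
  proof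
    show "r (n + m) * F (- m) (n + m) / r (n + m + - m) = cnj (r n * F m n / r (n + m))" for m n
      using F_adj[of m n] nz by (simp add: cr field_simps)
    show "cnj (r n * G m n / r (n + m)) = e * (r (n + m) * G (- m) (n + m) / r (n + m + - m))" if "m \<noteq> 0" for m n
      using G_adj[OF that, of n] nz by (simp add: cr field_simps)
  qed (use I0_adj e_unit in auto)
qed

section \<open>Moduli and triple product of the coefficients of \<open>Lb 1\<close> and
  \<open>Lb 2\<close>\<close>

definition x :: "int \<Rightarrow> real" where "x n = a + of_int n"

lemma x_add: "x (n + m) = x n + of_int m" "x (n - m) = x n - of_int m"
  by (simp_all add: x_def)

lemma F_0: "F 0 n = of_real (x n)"
  by (simp add: L0 x_def)

lemma F_neg: "F (- m) n = cnj (F m (n - m))"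
  using F_adj[of m "n - m"] by simp

text \<open>This is the bracket of \<open>Lb (- m)\<close> and \<open>Lb m\<close>; by adjointness
  both products of coefficients are squared moduli.\<close>

lemma norm_F_diff:
  "of_real ((cmod (F m n))\<^sup>2 - (cmod (F m (n - m)))\<^sup>2) =
    of_real (2 * of_int m * x n) - (of_int m ^ 3 - of_int m) / 12 * z"
proof -
  have "F (- m) (n + m) * F m n - F m (n - m) * F (- m) n =
    of_int (2 * m) * of_real (x n) + (of_int (- m) ^ 3 - of_int (- m)) / 12 * z"
    using LL[of "- m" n m] by (simp add: F_0)
  also have "F (- m) (n + m) * F m n = of_real ((cmod (F m n))\<^sup>2)"
    unfolding F_adj complex_norm_square by (rule mult.commute)
  also have "F m (n - m) * F (- m) n = of_real ((cmod (F m (n - m)))\<^sup>2)"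
    by (simp only: F_neg complex_norm_square)
  finally show ?thesis by (simp add: field_simps)
qed

text \<open>At \<open>m = 1\<close> the central term of \<open>norm_F_diff\<close> vanishes;
  \<open>p\<close> is the constant of summation.\<close>

lemma norm_F1:
  obtains p where "\<And>n. (cmod (F 1 n))\<^sup>2 = (x n)\<^sup>2 + x n + p"
proof -
  define f where "f n = (cmod (F 1 n))\<^sup>2 - (x n)\<^sup>2 - x n" for n
  have "f (n + 1) = f n" for n
  proof -
    have "complex_of_real ((cmod (F 1 (n + 1)))\<^sup>2 - (cmod (F 1 n))\<^sup>2) = of_real (2 * x (n + 1))"
      using norm_F_diff[of 1 "n + 1"] by simp
    then have "(cmod (F 1 (n + 1)))\<^sup>2 - (cmod (F 1 n))\<^sup>2 = 2 * x (n + 1)"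
      unfolding of_real_eq_iff .
    then show ?thesis
      by (simp add: f_def x_def power2_eq_square algebra_simps)
  qed
  then have "f n = f 0" for n
    by (rule int_step_constant)
  then show thesis
    using that[of "f 0"] by (simp add: f_def algebra_simps)
qed

text \<open>At \<open>m = 2\<close> all other terms of \<open>norm_F_diff\<close> are real. The
  factor 4 turns the central term \<open>z / 2\<close> into \<open>2 * \<zeta>\<close>.\<close>

lemma z_real: obtains \<zeta> where "z = of_real (4 * \<zeta>)"
proof -
  define D where "D = (cmod (F 2 0))\<^sup>2 - (cmod (F 2 (0 - 2)))\<^sup>2"
  have "of_real D = of_real (4 * x 0) - z / 2"
    using norm_F_diff[of 2 0] unfolding D_def by simp
  then have "of_real D = of_real (4 * x 0) - z / 2" .
  then have "z = 2 * (of_real (4 * x 0) - of_real D)"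
    by simp
  then have "z = of_real (4 * ((4 * x 0 - D) / 2))"
    by simp
  then show thesis by (rule that)
qed

text \<open>The recursion has step 2, so a priori \<open>Q\<close> depends on the parity class of
  \<open>n\<close>.\<close>

lemma norm_F2:
  assumes "z = of_real (4 * \<zeta>)"
  obtains Q where "\<And>k. (cmod (F 2 (n + 2 * k)))\<^sup>2 = (x (n + 2 * k) + 1)\<^sup>2 - \<zeta> * (x (n + 2 * k) + 1) + Q"
proof -
  define f where "f n = (cmod (F 2 n))\<^sup>2 - (x n + 1)\<^sup>2 + \<zeta> * (x n + 1)" for n
  have "f (n + 2) = f n" for n
  proof -
    have "complex_of_real ((cmod (F 2 (n + 2)))\<^sup>2 - (cmod (F 2 n))\<^sup>2) = of_real (4 * x (n + 2) - 2 * \<zeta>)"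
      using norm_F_diff[of 2 "n + 2"] by (simp add: assms)
    then have "(cmod (F 2 (n + 2)))\<^sup>2 - (cmod (F 2 n))\<^sup>2 = 4 * x (n + 2) - 2 * \<zeta>"
      unfolding of_real_eq_iff .
    then show ?thesis
      by (simp add: f_def x_def power2_eq_square algebra_simps)
  qed
  then have "f (n + 2 * k) = f n" for k
    by (rule int_step_periodic)
  then show thesis
    using that[of "f n"] by (simp add: f_def algebra_simps)
qed

lemma F_2_1_rel: "cnj (F 1 (n + 1)) * F 2 n - F 2 (n - 1) * cnj (F 1 (n - 1)) = 3 * F 1 n"
  using LL[of "- 1" n 2] F_neg[of 1 "n + 2"] F_neg[of 1 n] by (simp add: algebra_simps)

text \<open>The product does not change under a gauge by phases. Multiplying
  \<open>F_2_1_rel\<close> by the conjugate of \<open>F 1\<close> makes its left side a difference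
  of consecutive products and its right side three times a squared modulus, which sums to a
  cubic.\<close>

lemma triple_product:
  assumes p: "\<And>n. (cmod (F 1 n))\<^sup>2 = (x n)\<^sup>2 + x n + p"
  obtains \<sigma> where "\<And>n. F 2 n * cnj (F 1 n * F 1 (n + 1)) =
    of_real ((x n + 1) ^ 3 + (3 * p - 1) * (x n + 1)) + \<sigma>"
proof -
  define t where "t n = F 2 n * cnj (F 1 n * F 1 (n + 1))" for n
  define f where "f n = t n - of_real ((x n + 1) ^ 3 + (3 * p - 1) * (x n + 1))" for n
  have "f (n + 1) = f n" for n
  proof -
    have "t (n + 1) - t n = (cnj (F 1 (n + 1 + 1)) * F 2 (n + 1) - F 2 (n + 1 - 1) * cnj (F 1 (n + 1 - 1))) * cnj (F 1 (n + 1))"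
      by (simp add: t_def algebra_simps)
    also have "\<dots> = 3 * of_real ((cmod (F 1 (n + 1)))\<^sup>2)"
      unfolding F_2_1_rel by (simp only: complex_norm_square mult_ac)
    finally have t: "t (n + 1) = t n + 3 * of_real ((x (n + 1))\<^sup>2 + x (n + 1) + p)"
      by (simp add: p algebra_simps)
    show ?thesis
      unfolding f_def t by (simp add: x_def power2_eq_square power3_eq_cube algebra_simps)
  qed
  then have "f n = f 0" for n
    by (rule int_step_constant)
  then show thesis
    using that[of "f 0"] by (simp add: f_def t_def algebra_simps)
qed

lemma triple_product_norm_identity:
  assumes p: "\<And>n. (cmod (F 1 n))\<^sup>2 = (x n)\<^sup>2 + x n + p"
    and \<sigma>: "\<And>n. F 2 n * cnj (F 1 n * F 1 (n + 1)) =
      of_real ((x n + 1) ^ 3 + (3 * p - 1) * (x n + 1)) + \<sigma>"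
  shows "z = 0" "Re \<sigma> = 0" "(Im \<sigma>)\<^sup>2 = (4 * p - 1) * p\<^sup>2"
    "(cmod (F 2 n))\<^sup>2 = (x n + 1)\<^sup>2 + 4 * p - 1"
proof -
  obtain \<zeta> where \<zeta>: "z = of_real (4 * \<zeta>)" by (rule z_real)
  obtain Q where Q: "\<And>k. (cmod (F 2 (n + 2 * k)))\<^sup>2 =
      (x (n + 2 * k) + 1)\<^sup>2 - \<zeta> * (x (n + 2 * k) + 1) + Q"
    using norm_F2[OF \<zeta>, of n] by blast
  \<comment> \<open>\<open>D\<close> is the squared modulus of the cubic minus the product of the
    three quadratics, in the variable \<open>x n + 1\<close>; the terms of degree 6 cancel. Degrees
    5 and 4 give \<open>\<zeta>\<close> and \<open>Q\<close>, degree 3 gives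
    \<open>Re \<sigma>\<close>, degree 0 gives \<open>Im \<sigma>\<close>.\<close>
  define D where "D = [: (Re \<sigma>)\<^sup>2 + (Im \<sigma>)\<^sup>2 - Q * p\<^sup>2, 2 * Re \<sigma> * (3 * p - 1) + \<zeta> * p\<^sup>2,
      (3 * p - 1)\<^sup>2 - p\<^sup>2 - Q * (2 * p - 1), 2 * Re \<sigma> + \<zeta> * (2 * p - 1), 4 * p - 1 - Q, \<zeta> :]"
  have "poly D (x n + 1 + 2 * of_int k) = 0" for k
  proof -
    define y where "y = x (n + 2 * k) + 1"
    have "(cmod (F 2 (n + 2 * k) * cnj (F 1 (n + 2 * k) * F 1 (n + 2 * k + 1))))\<^sup>2 =
        (cmod (F 2 (n + 2 * k)))\<^sup>2 * (cmod (F 1 (n + 2 * k)))\<^sup>2 * (cmod (F 1 (n + 2 * k + 1)))\<^sup>2"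
      by (simp add: norm_mult power_mult_distrib)
    also have "\<dots> = (y\<^sup>2 - \<zeta> * y + Q) * ((y - 1)\<^sup>2 + (y - 1) + p) * (y\<^sup>2 + y + p)"
      unfolding Q p y_def by (simp add: x_def algebra_simps)
    finally have "(cmod (of_real (y ^ 3 + (3 * p - 1) * y) + \<sigma>))\<^sup>2 =
        (y\<^sup>2 - \<zeta> * y + Q) * ((y - 1)\<^sup>2 + (y - 1) + p) * (y\<^sup>2 + y + p)"
      unfolding \<sigma> y_def .
    then have "(y ^ 3 + (3 * p - 1) * y + Re \<sigma>)\<^sup>2 + (Im \<sigma>)\<^sup>2 =
        (y\<^sup>2 - \<zeta> * y + Q) * ((y - 1)\<^sup>2 + (y - 1) + p) * (y\<^sup>2 + y + p)"
      by (simp add: cmod_power2)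
    moreover have "x n + 1 + 2 * of_int k = y"
      by (simp add: y_def x_def)
    ultimately show ?thesis
      by (simp add: D_def power2_eq_square power3_eq_cube algebra_simps)
  qed
  then have "D = 0"
    by (rule poly_eq_0_on_progression) simp
  then have *: "\<zeta> = 0" "Q = 4 * p - 1" "2 * Re \<sigma> + \<zeta> * (2 * p - 1) = 0"
    "(Re \<sigma>)\<^sup>2 + (Im \<sigma>)\<^sup>2 = Q * p\<^sup>2"
    by (auto simp: D_def)
  then show "z = 0" and \<sigma>0: "Re \<sigma> = 0"
    using \<zeta> by simp_all
  show "(Im \<sigma>)\<^sup>2 = (4 * p - 1) * p\<^sup>2"
    using * \<sigma>0 by simp
  show "(cmod (F 2 n))\<^sup>2 = (x n + 1)\<^sup>2 + 4 * p - 1"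
    using Q[of 0] * by simp
qed

lemma structure_constants:
  obtains t :: real where "z = 0" "\<And>n. (cmod (F 1 n))\<^sup>2 = (x n + 1 / 2)\<^sup>2 + t\<^sup>2"
    "\<And>n. (cmod (F 2 n))\<^sup>2 = (x n + 1)\<^sup>2 + 4 * t\<^sup>2"
    "\<And>n. F 2 n * cnj (F 1 n * F 1 (n + 1)) = (of_real (x n) + 2 * (Complex (1 / 2) t)) *
      cnj ((of_real (x n) + Complex (1 / 2) t) * (of_real (x (n + 1)) + Complex (1 / 2) t))"
proof -
  obtain p where p: "\<And>n. (cmod (F 1 n))\<^sup>2 = (x n)\<^sup>2 + x n + p"
    using norm_F1 by blast
  obtain \<sigma> where \<sigma>: "\<And>n. F 2 n * cnj (F 1 n * F 1 (n + 1)) =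
      of_real ((x n + 1) ^ 3 + (3 * p - 1) * (x n + 1)) + \<sigma>"
    using triple_product[OF p] by blast
  note id = triple_product_norm_identity[OF p \<sigma>]
  have "p \<noteq> 0"
  proof
    assume p0: "p = 0"
    \<comment> \<open>The index \<open>N\<close> has its weight in the interval [-1, 0), where
      \<open>p = 0\<close> would make the squared modulus of \<open>F 2 N\<close> equal to
      \<open>x N * (x N + 2) < 0\<close>.\<close>
    define N where "N = - \<lfloor>a\<rfloor> - 1"
    have N: "- 1 \<le> x N" "x N < 0"
      unfolding N_def x_def by (simp_all, linarith+)
    have "0 \<le> x N * (x N + 1)" "0 \<le> x N * (x N + 2)"
      using zero_le_power2[of "cmod (F 1 N)"] zero_le_power2[of "cmod (F 2 N)"]
      unfolding p id(4) by (simp_all add: p0 power2_eq_square algebra_simps)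
    with N show False
      by (smt (verit) mult_neg_pos)
  qed
  have "0 \<le> (4 * p - 1) * p\<^sup>2"
    unfolding id(3)[symmetric] by simp
  with \<open>p \<noteq> 0\<close> have "4 * p - 1 \<ge> 0"
    by (simp add: zero_le_mult_iff)
  \<comment> \<open>The relation for \<open>Im \<sigma>\<close> fixes \<open>t\<close> only up to
    sign. This choice gives \<open>\<sigma>\<close> the value that belongs to
    \<open>b = 1/2 + \<i> t\<close> rather than to its conjugate.\<close>
  define t where "t = - Im \<sigma> / (2 * p)"
  have t: "Im \<sigma> = - 2 * p * t"
    using \<open>p \<noteq> 0\<close> by (simp add: t_def)
  have "p\<^sup>2 * (4 * t\<^sup>2) = p\<^sup>2 * (4 * p - 1)"
    using id(3) unfolding t by (simp add: power_mult_distrib)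
  then have "4 * t\<^sup>2 = 4 * p - 1"
    using \<open>p \<noteq> 0\<close> by simp
  then have pt: "p = 1 / 4 + t\<^sup>2" by simp
  show thesis
  proof (rule that[of t])
    fix n
    show "(cmod (F 1 n))\<^sup>2 = (x n + 1 / 2)\<^sup>2 + t\<^sup>2"
      unfolding p pt by (simp add: power2_eq_square algebra_simps)
    show "(cmod (F 2 n))\<^sup>2 = (x n + 1)\<^sup>2 + 4 * t\<^sup>2"
      unfolding id(4) pt by simp
    have s: "\<sigma> = Complex 0 (- 2 * p * t)"
      using id(2) t by (simp add: complex_eq_iff)
    show "F 2 n * cnj (F 1 n * F 1 (n + 1)) = (of_real (x n) + 2 * (Complex (1 / 2) t)) *
      cnj ((of_real (x n) + Complex (1 / 2) t) * (of_real (x (n + 1)) + Complex (1 / 2) t))"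
      unfolding \<sigma> s pt
      by (simp add: complex_eq_iff x_def, simp add: power2_eq_square power3_eq_cube field_simps)
  qed (rule id(1))
qed

text \<open>By \<open>P1\<close> the numbers \<open>F 1 n\<close> and \<open>x n + b\<close> differ
  by a phase \<open>d n\<close>, and \<open>\<phi>\<close> accumulates these phases. The triple
  product shows that the same \<open>\<phi>\<close> also normalises \<open>F 2\<close>.\<close>

lemma phases_exist:
  fixes t :: real
  defines "b \<equiv> Complex (1 / 2) t"
  assumes P1: "\<And>n. (cmod (F 1 n))\<^sup>2 = (x n + 1 / 2)\<^sup>2 + t\<^sup>2"
    and P2: "\<And>n. (cmod (F 2 n))\<^sup>2 = (x n + 1)\<^sup>2 + 4 * t\<^sup>2"
    and triple: "\<And>n. F 2 n * cnj (F 1 n * F 1 (n + 1)) =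
      (of_real (x n) + 2 * b) * cnj ((of_real (x n) + b) * (of_real (x (n + 1)) + b))"
  obtains \<phi> where "\<And>n. cmod (\<phi> n) = 1"
    "\<And>n. \<phi> n * F 1 n = \<phi> (n + 1) * (of_real (x n) + b)"
    "\<And>n. \<phi> n * F 2 n = \<phi> (n + 2) * (of_real (x n) + 2 * b)"
proof -
  define u where "u n = of_real (x n) + b" for n
  define s where "s n = of_real (x n) + 2 * b" for n
  have cF1: "cmod (F 1 n) = cmod (u n)" for n
  proof (rule power2_eq_imp_eq)
    show "(cmod (F 1 n))\<^sup>2 = (cmod (u n))\<^sup>2"
      unfolding P1 by (simp add: u_def b_def cmod_power2)
  qed simp_all
  have cF2: "cmod (F 2 n) = cmod (s n)" for n
  proof (rule power2_eq_imp_eq)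
    show "(cmod (F 2 n))\<^sup>2 = (cmod (s n))\<^sup>2"
      unfolding P2 by (simp add: s_def b_def cmod_power2 power_mult_distrib)
  qed simp_all
  have u0: "t = 0 \<and> x n = - 1 / 2" if "u n = 0" for n
    using that by (auto simp: u_def b_def complex_eq_iff)
  have near: "s n = 1 / 2" "u (n + 1) = 1" "u (n - 1) = - 1" "s (n - 1) = - 1 / 2" "s n \<noteq> 0" if "u n = 0" for n
    using u0[OF that] by (auto simp: u_def s_def b_def complex_eq_iff x_add)
  \<comment> \<open>If \<open>t = 0\<close> and \<open>a\<close> is a half-integer, \<open>F 1 n\<close> vanishes where \<open>x n = - 1 / 2\<close>; across that gap
    the phases are linked by \<open>F 2 n\<close>.\<close>
  define d where "d n = (if u n \<noteq> 0 then F 1 n / u n else (F 2 n / s n) / (F 1 (n + 1) / u (n + 1)))" for n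
  have d1: "cmod (d n) = 1" for n
    using near[of n] by (cases "u n = 0") (simp_all add: d_def norm_divide norm_mult cF1 cF2)
  then have d0: "d n \<noteq> 0" for n
    by (metis norm_zero zero_neq_one)
  have dd: "d n * cnj (d n) = 1" for n
    using d1[of n] by (simp add: complex_norm_square[symmetric])
  have du: "F 1 n = d n * u n" for n
    using cF1[of n] by (cases "u n = 0") (simp_all add: d_def)
  have ds: "F 2 n = d (n + 1) * d n * s n" for n
  proof -
    consider "u n = 0" | "u (n + 1) = 0" | "u n \<noteq> 0" "u (n + 1) \<noteq> 0" by blast
    then show ?thesis
    proof cases
      case 1
      then have "d n = F 2 n / s n / d (n + 1)"
        using near[OF 1] by (simp add: d_def)
      with near[OF 1] d0[of "n + 1"] show ?thesis by simp
    next
      \<comment> \<open>Here \<open>F 1 (n + 1) = 0\<close> and the triple product is silent about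
        \<open>F 2 n\<close>. Since \<open>d (n + 1)\<close> was defined through
        \<open>F 2 (n + 1)\<close>, \<open>F_2_1_rel\<close> across the gap supplies
        \<open>F 2 n\<close>.\<close>
      case 2
      have "d (n + 1) = F 2 (n + 1) / s (n + 1) / d (n + 1 + 1)"
        using near[OF 2] 2 by (simp add: d_def)
      then have "F 2 (n + 1) = d (n + 1) * d (n + 2) / 2"
        using near[OF 2] d0[of "n + 2"] by (simp add: add.assoc)
      moreover have "F 1 (n + 2) = d (n + 2)" "F 1 n = - d n" "F 1 (n + 1) = 0"
        using near[OF 2] 2 by (simp_all add: du add.assoc)
      moreover have "cnj (F 1 (n + 2)) * F 2 (n + 1) - F 2 n * cnj (F 1 n) = 3 * F 1 (n + 1)"
        using F_2_1_rel[of "n + 1"] by (simp add: add.assoc)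
      ultimately have "cnj (d (n + 2)) * (d (n + 1) * d (n + 2) / 2) + F 2 n * cnj (d n) = 0"
        by (simp only:) simp
      moreover have "cnj (d (n + 2)) * (d (n + 1) * d (n + 2) / 2) =
          d (n + 2) * cnj (d (n + 2)) * (d (n + 1) / 2)"
        by simp
      ultimately have "d (n + 1) / 2 + F 2 n * cnj (d n) = 0"
        by (simp only: dd mult_1)
      then have "F 2 n * cnj (d n) = - (d (n + 1) / 2)"
        by (simp only: eq_neg_iff_add_eq_0 add.commute)
      then have "F 2 n * cnj (d n) * d n = - (d (n + 1) / 2) * d n"
        by simp
      moreover have "F 2 n * cnj (d n) * d n = F 2 n * (d n * cnj (d n))"
        by (simp add: mult_ac)
      ultimately show ?thesis
        using near(4)[OF 2] by (simp add: dd)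
    next
      case 3
      have "(F 2 n * cnj (d n * d (n + 1))) * cnj (u n * u (n + 1)) = s n * cnj (u n * u (n + 1))"
        using triple[of n] unfolding du by (simp add: u_def s_def mult_ac)
      with 3 have "F 2 n * cnj (d n * d (n + 1)) = s n"
        by simp
      then have "d (n + 1) * d n * s n = F 2 n * (d n * cnj (d n)) * (d (n + 1) * cnj (d (n + 1)))"
        by (simp add: mult_ac flip: \<open>F 2 n * cnj (d n * d (n + 1)) = s n\<close>)
      then show ?thesis by (simp add: dd)
    qed
  qed
  obtain \<phi> where \<phi>: "\<And>n. \<phi> (n + 1) = d n * \<phi> n" "\<phi> 0 = 1"
    using int_recursion_exists[of d] d0 by blast
  have "cmod (\<phi> n) = cmod (\<phi> 0)" for n
    by (rule int_step_constant) (simp add: \<phi> norm_mult d1)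
  then have "cmod (\<phi> n) = 1" for n
    by (simp add: \<phi>)
  moreover have "\<phi> n * F 1 n = \<phi> (n + 1) * (of_real (x n) + b)" for n
    by (simp add: \<phi> du u_def)
  moreover have "\<phi> n * F 2 n = \<phi> (n + 2) * (of_real (x n) + 2 * b)" for n
    using \<phi>(1)[of "n + 1"] by (simp add: \<phi>(1)[of n] ds s_def add.assoc)
  ultimately show thesis by (rule that)
qed

text \<open>For positive \<open>m\<close>, \<open>Lb 1\<close> and \<open>Lb 2\<close> generate
  everything through the bracket of \<open>Lb 1\<close> and \<open>Lb i\<close>, whose factor
  \<open>i - 1\<close> is nonzero for \<open>i\<close> at least 2. Negative \<open>m\<close> follows
  by adjointness, because \<open>Re b = 1/2\<close>.\<close>

lemma F_eqI:
  fixes t :: real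
  defines "b \<equiv> Complex (1 / 2) t"
  assumes F1: "\<And>n. F 1 n = of_real (x n) + b"
    and F2: "\<And>n. F 2 n = of_real (x n) + 2 * b"
  shows "F m n = of_real (x n) + of_int m * b"
proof -
  have pos: "F m n = of_real (x n) + of_int m * b" if "m \<ge> 1" for m n
  proof (cases "m = 1")
    case False
    with that have "m \<ge> 2" by simp
    then show ?thesis
    proof (induction m arbitrary: n rule: int_ge_induct)
      case (step i)
      have "of_int (i - 1) * F (1 + i) n = of_int (i - 1) * (of_real (x n) + of_int (i + 1) * b)"
        using LL[of 1 n i] step.hyps unfolding step.IH F1
        by (simp add: x_def algebra_simps)
      moreover have "of_int (i - 1) \<noteq> (0::complex)"
        using step.hyps by (simp del: of_int_diff)
      ultimately show ?case
        by (simp del: of_int_diff add: add.commute)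
    qed (use F2 in simp)
  qed (use F1 in simp)
  consider "m \<ge> 1" | "m = 0" | "- m \<ge> 1" by linarith
  then show ?thesis
  proof cases
    case 3
    show ?thesis
      using F_neg[of "- m" n] pos[OF 3, of "n + m"]
      by (simp add: x_def complex_eq_iff b_def)
  qed (simp_all add: pos F_0)
qed

text \<open>The bracket of \<open>Ib (- 1)\<close> and \<open>Ib 1\<close> makes the squared moduli
  an arithmetic progression over all integers; it stays nonnegative in both directions only if its
  step, a unit multiple of \<open>\<kappa>\<close>, is 0.\<close>

lemma G1_norm_constant:
  shows "\<kappa> = 0" and "cmod (G 1 n) = cmod (G 1 0)"
proof -
  have G: "G (- 1) (n + 1) = cnj e * cnj (G 1 n)" for n
    using G_adj[of 1 n] e_unit by (simp add: mult.assoc[symmetric])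
  have *: "cnj e * of_real ((cmod (G 1 n))\<^sup>2 - (cmod (G 1 (n - 1)))\<^sup>2) = \<kappa>" for n
    using II[of "- 1" n 1] G[of n] G[of "n - 1"]
    by (simp add: complex_norm_square algebra_simps del: of_real_power)
  define K where "K = e * \<kappa>"
  have K: "of_real ((cmod (G 1 n))\<^sup>2 - (cmod (G 1 (n - 1)))\<^sup>2) = K" for n
    unfolding K_def *[of n, symmetric] using e_unit by (simp add: mult_ac flip: mult.assoc)
  define k where "k = Re K"
  have k: "(cmod (G 1 n))\<^sup>2 - (cmod (G 1 (n - 1)))\<^sup>2 = k" for n
    unfolding k_def K[of n, symmetric] by simp
  define f where "f n = (cmod (G 1 n))\<^sup>2 - k * of_int n" for n
  have "f (n + 1) = f n" for n
    using k[of "n + 1"] by (simp add: f_def algebra_simps)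
  then have f: "f n = f 0" for n
    by (rule int_step_constant)
  have G2: "(cmod (G 1 n))\<^sup>2 = f 0 + k * of_int n" for n
    using f[of n] by (simp add: f_def)
  have "k = 0"
  proof (rule ccontr)
    assume "k \<noteq> 0"
    define N where "N = \<lceil>(\<bar>f 0\<bar> + 1) / \<bar>k\<bar>\<rceil>"
    have "(\<bar>f 0\<bar> + 1) / \<bar>k\<bar> \<le> of_int N"
      by (simp add: N_def)
    then have N: "\<bar>f 0\<bar> + 1 \<le> \<bar>k\<bar> * of_int N"
      using \<open>k \<noteq> 0\<close> by (simp add: field_simps)
    have "0 \<le> f 0 + k * of_int N" "0 \<le> f 0 + k * of_int (- N)"
      unfolding G2[symmetric] by simp_all
    with N show False by (cases "k \<ge> 0") auto
  qed
  moreover have "K = of_real k"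
    unfolding K[of 0, symmetric] k[of 0, symmetric] ..
  ultimately have "K = 0" by simp
  then show "\<kappa> = 0"
    using e_unit by (auto simp: K_def)
  show "cmod (G 1 n) = cmod (G 1 0)"
    using G2[of n] G2[of 0] \<open>k = 0\<close> by (simp add: power2_eq_imp_eq)
qed

end

section \<open>Coefficients of \<open>Ib m\<close> once those of \<open>Lb m\<close> are
  normalised\<close>

locale normalized_hv_coeffs = unitary_hv_coeffs +
  fixes t :: real and b :: complex
  assumes b_def: "b = Complex (1 / 2) t"
    and F_eq: "F m n = of_real (x n) + of_int m * b"
begin

lemma cnj_b: "cnj b = 1 - b"
  by (simp add: b_def complex_eq_iff)

text \<open>The bracket of \<open>Lb (- 1)\<close> and \<open>Ib 1\<close> is
  \<open>I\<^sub>0 + 2 C\<^sub>L\<^sub>I\<close>, so the left side grows by \<open>c + 2 * w\<close>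
  at each step.\<close>

lemma G1_linear:
  obtains \<rho> where "\<And>n. G 1 n * (of_real (x n) + 1 - b) = (c + 2 * w) * of_real (x n) + \<rho>"
proof -
  define f where "f n = G 1 n * (of_real (x n) + 1 - b) - (c + 2 * w) * of_real (x n)" for n
  have "f (n + 1) = f n" for n
    using LI[of "- 1" "n + 1" 1] by (simp add: f_def F_eq x_def I0 algebra_simps)
  then have "f n = f 0" for n
    by (rule int_step_constant)
  then show thesis
    using that[of "f 0"] by (simp add: f_def algebra_simps)
qed

text \<open>The bracket of \<open>Lb (- 2)\<close> and \<open>Ib 1\<close> is
  \<open>Ib (- 1)\<close>, whose coefficients are expressed through \<open>G 1\<close> by
  adjointness.\<close>

lemma G1_rel:
  "G 1 n * (of_real (x n) + 1 - 2 * b) - G 1 (n - 2) * (of_real (x n) - 2 * b) = cnj e * cnj (G 1 (n - 1))"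
proof -
  have "G (- 1) n = cnj e * cnj (G 1 (n - 1))"
    using G_adj[of 1 "n - 1"] e_unit by (simp add: mult.assoc[symmetric])
  then show ?thesis
    using LI[of "- 2" n 1] by (simp add: F_eq x_def algebra_simps)
qed

text \<open>The moduli of \<open>G 1 n\<close> only determine it up to replacing \<open>b\<close> by \<open>1 - b\<close>; the relation
  \<open>[L\<^sub>-\<^sub>2, I\<^sub>1] = I\<^sub>-\<^sub>1\<close> decides between the two.\<close>

lemma G1_constant: "G 1 n = c + 2 * w"
proof (cases "G 1 0 = 0")
  case True
  then have G0: "G 1 n = 0" for n
    using G1_norm_constant(2)[of n] by simp
  obtain \<rho> where "\<And>n. G 1 n * (of_real (x n) + 1 - b) = (c + 2 * w) * of_real (x n) + \<rho>"
    using G1_linear by blast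
  from this[of 1] this[of 0] have "(c + 2 * w) * of_real (x 1) + \<rho> - ((c + 2 * w) * of_real (x 0) + \<rho>) = 0"
    unfolding G0 by simp
  then have "c + 2 * w = 0"
    by (simp add: x_def algebra_simps)
  with G0 show ?thesis by simp
next
  case False
  define C where "C = c + 2 * w"
  obtain \<rho> where \<rho>: "\<And>n. G 1 n * (of_real (x n) + 1 - b) = C * of_real (x n) + \<rho>"
    unfolding C_def using G1_linear by blast
  define M where "M = (cmod (G 1 0))\<^sup>2"
  have "M \<noteq> 0" using False by (simp add: M_def)
  \<comment> \<open>\<open>D\<close> compares squared moduli in \<open>G1_linear\<close>, where
    \<open>G 1 n\<close> has constant squared modulus \<open>M\<close>. Its vanishing leaves for
    \<open>\<rho> / C\<close> only \<open>b\<close> and the conjugate \<open>1 - b\<close>.\<close>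
  define D where "D = [: (cmod \<rho>)\<^sup>2 - M * (1 / 4 + t\<^sup>2), 2 * Re (C * cnj \<rho>) - M, (cmod C)\<^sup>2 - M :]"
  have "poly D (a + 1 * of_int n) = 0" for n
  proof -
    have "(cmod (C * of_real (x n) + \<rho>))\<^sup>2 = M * (cmod (of_real (x n) + 1 - b))\<^sup>2"
      unfolding \<rho>[symmetric] norm_mult power_mult_distrib G1_norm_constant(2)[of n] M_def ..
    then show ?thesis
      unfolding cmod_power2 D_def
      by (simp add: b_def x_def) (simp add: power2_eq_square field_simps)
  qed
  then have "D = 0"
    by (rule poly_eq_0_on_progression) simp
  then have D: "(cmod C)\<^sup>2 = M" "2 * Re (C * cnj \<rho>) = M" "(cmod \<rho>)\<^sup>2 = M * (1 / 4 + t\<^sup>2)"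
    by (auto simp: D_def)
  have "C \<noteq> 0" using D(1) \<open>M \<noteq> 0\<close> by auto
  define \<beta> where "\<beta> = \<rho> / C"
  have \<rho>\<beta>: "\<rho> = C * \<beta>" using \<open>C \<noteq> 0\<close> by (simp add: \<beta>_def)
  have "C * cnj \<rho> = of_real M * cnj \<beta>"
    unfolding \<rho>\<beta> D(1)[symmetric] complex_norm_square by simp
  with D(2) \<open>M \<noteq> 0\<close> have Re\<beta>: "Re \<beta> = 1 / 2" by simp
  have "(cmod \<beta>)\<^sup>2 = 1 / 4 + t\<^sup>2"
    using D(3) \<open>M \<noteq> 0\<close> unfolding \<rho>\<beta> norm_mult power_mult_distrib D(1) by simp
  then have "(Im \<beta>)\<^sup>2 = t\<^sup>2"
    unfolding cmod_power2 Re\<beta> by (simp add: power2_eq_square)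
  then have "\<beta> = 1 - b \<or> \<beta> = b \<and> t \<noteq> 0"
    by (cases "t = 0") (auto simp: power2_eq_iff Re\<beta> b_def complex_eq_iff)
  then consider "\<beta> = 1 - b" | "\<beta> = b" "t \<noteq> 0"
    by blast
  then show ?thesis
  proof cases
    case 1
    have GC: "G 1 n = C" if "of_real (x n) + 1 - b \<noteq> 0" for n
    proof -
      have "G 1 n * (of_real (x n) + 1 - b) = C * (of_real (x n) + 1 - b)"
        unfolding \<rho> \<rho>\<beta> 1 by (simp add: algebra_simps)
      with that show ?thesis by simp
    qed
    show ?thesis
    proof (cases "of_real (x n) + 1 - b = 0")
      \<comment> \<open>At this weight \<open>G1_linear\<close> does not determine
        \<open>G 1 n\<close>. Instead, \<open>G1_rel\<close> at \<open>n + 3\<close> avoids the gap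
        and gives \<open>C = cnj e * cnj C\<close>, after which \<open>G1_rel\<close> at
        \<open>n\<close> yields \<open>G 1 n\<close>.\<close>
      case True
      then have t: "t = 0" "x n = - 1 / 2"
        by (simp_all add: b_def complex_eq_iff)
      then have "G 1 (n + j) = C" if "j \<noteq> 0" for j
        using that by (intro GC) (auto simp: b_def complex_eq_iff x_add)
      from this[of "- 1"] this[of "- 2"] this[of 1] this[of 2] this[of 3]
      have nb: "G 1 (n - 1) = C" "G 1 (n - 2) = C" "G 1 (n + 1) = C" "G 1 (n + 2) = C" "G 1 (n + 3) = C"
        by simp_all
      have b: "b = 1 / 2" by (simp add: b_def t complex_eq_iff)
      have "C = cnj e * cnj C"
        using G1_rel[of "n + 3"] nb by (simp add: x_add t b algebra_simps)
      moreover have "G 1 n * (- 1 / 2) - C * (- 3 / 2) = cnj e * cnj C"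
        using G1_rel[of n] unfolding nb by (simp add: t b)
      ultimately have "- 2 * (G 1 n * (- 1 / 2) - C * (- 3 / 2)) + 3 * C = C"
        by simp
      moreover have "- 2 * (G 1 n * (- 1 / 2) - C * (- 3 / 2)) + 3 * C = G 1 n"
        by (simp add: algebra_simps)
      ultimately show ?thesis
        unfolding C_def by metis
    qed (use GC in \<open>simp add: C_def\<close>)
  next
    case 2
    define X where "X n = complex_of_real (x n)" for n
    have nz: "X n + 1 - b \<noteq> 0" "X n + b \<noteq> 0" for n
      using 2(2) by (simp_all add: X_def b_def complex_eq_iff)
    have G: "G 1 n = C * (X n + b) / (X n + 1 - b)" for n
      using \<rho>[of n] nz[of n] by (simp add: X_def \<rho>\<beta> 2(1) field_simps)
    have Gc: "cnj (G 1 n) = cnj C * (X n + 1 - b) / (X n + b)" for n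
      unfolding G by (simp add: X_def cnj_b add_diff_eq)
    \<comment> \<open>\<open>E\<close> is \<open>G1_rel\<close> for the candidate
      \<open>C * (X n + b) / (X n + 1 - b)\<close>, cleared of denominators.\<close>
    define E where "E = [: C :] * [: b, 1 :] * [: 1 - 2 * b, 1 :] * [: - 1 - b, 1 :] * [: b - 1, 1 :]
      - [: C :] * [: b - 2, 1 :] * [: - 2 * b, 1 :] * [: 1 - b, 1 :] * [: b - 1, 1 :]
      - [: cnj e * cnj C :] * [: - b, 1 :] * [: 1 - b, 1 :] * [: - 1 - b, 1 :]"
    have "poly E (of_real a + 1 * of_int n) = 0" for n
    proof -
      have X: "X (n - 1) = X n - 1" "X (n - 2) = X n - 2" by (simp_all add: X_def x_def)
      have n1: "X n - 1 - b \<noteq> 0" "X n + b - 1 \<noteq> 0"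
        using nz(1)[of "n - 2"] nz(2)[of "n - 1"] by (simp_all add: X algebra_simps)
      have "C * (X n + b) / (X n + 1 - b) * (X n + 1 - 2 * b) -
          C * (X n + b - 2) / (X n - 1 - b) * (X n - 2 * b) =
          cnj e * (cnj C * (X n - b) / (X n + b - 1))"
        using G1_rel[of n] unfolding Gc unfolding G X_def[symmetric] X by (simp add: algebra_simps)
      then have "C * (X n + b) * (X n + 1 - 2 * b) * (X n - 1 - b) * (X n + b - 1) -
          C * (X n + b - 2) * (X n - 2 * b) * (X n + 1 - b) * (X n + b - 1) =
          cnj e * (cnj C * (X n - b)) * (X n + 1 - b) * (X n - 1 - b)"
        using nz(1)[of n] n1 by (simp add: divide_simps, simp add: algebra_simps)
      moreover have "of_real a + 1 * of_int n = X n" by (simp add: X_def x_def)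
      ultimately show ?thesis
        unfolding E_def by (simp add: algebra_simps)
    qed
    then have "E = 0"
      by (rule poly_eq_0_on_progression) simp
    \<comment> \<open>At the pole \<open>b - 1\<close> of the candidate only the first product of
      \<open>E\<close> survives; the resulting values of \<open>b\<close> contradict
      \<open>t \<noteq> 0\<close>.\<close>
    then have "poly E (b - 1) = 0" by simp
    then have "C * (2 * b - 1) * (- b) * (- 2) * (2 * b - 2) = 0"
      unfolding E_def by (simp add: algebra_simps)
    then have "2 * b = 1 \<or> b = 0 \<or> b = 1"
      using \<open>C \<noteq> 0\<close> by auto
    with 2(2) show ?thesis
      by (auto simp: b_def complex_eq_iff)
  qed
qed

text \<open>With \<open>G 1\<close> constant, \<open>G1_rel\<close> says that
  \<open>c + 2 * w\<close> equals \<open>cnj e * cnj (c + 2 * w)\<close>, which is \<open>c\<close>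
  by \<open>I0_adj\<close>. The remaining \<open>G m\<close> come from the bracket of
  \<open>Lb (m - 1)\<close> and \<open>Ib 1\<close>.\<close>

lemma w_eq_0: "w = 0" and G_eq: "G m n = c"
proof -
  have c: "c = cnj e * cnj (c + 2 * w)"
    using arg_cong[OF I0_adj, of cnj] by simp
  have "c + 2 * w = cnj e * cnj (c + 2 * w)"
    unfolding G1_rel[of n, unfolded G1_constant, symmetric] by (simp add: algebra_simps)
  also have "\<dots> = c"
    by (rule c[symmetric])
  finally have "c + 2 * w = c" .
  then show w: "w = 0" by simp
  show "G m n = c"
  proof (cases "m = 0")
    case False
    have "G (1 + (m - 1)) n = c"
    proof (cases "m = 1")
      case True
      then show ?thesis using G1_constant[of n] w by simp
    next
      case False
      then show ?thesis
        using LI[of "m - 1" n 1] \<open>m \<noteq> 0\<close> unfolding G1_constant w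
        by (simp add: F_eq x_def algebra_simps)
    qed
    then show ?thesis by simp
  qed (simp add: I0)
qed

end

lemma (in unitary_hv_coeffs) intermediate_series_classification:
  obtains t :: real and \<phi> :: "int \<Rightarrow> complex" where
    "\<And>n. \<phi> n \<noteq> 0"
    "\<And>m n. \<phi> n * F m n = \<phi> (n + m) * (of_real a + of_int n + of_int m * Complex (1 / 2) t)"
    "\<And>m n. \<phi> n * G m n = \<phi> (n + m) * c"
    "z = 0" "w = 0" "\<kappa> = 0"
proof -
  obtain t where z: "z = 0" and P1: "\<And>n. (cmod (F 1 n))\<^sup>2 = (x n + 1 / 2)\<^sup>2 + t\<^sup>2"
    and P2: "\<And>n. (cmod (F 2 n))\<^sup>2 = (x n + 1)\<^sup>2 + 4 * t\<^sup>2"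
    and tr: "\<And>n. F 2 n * cnj (F 1 n * F 1 (n + 1)) = (of_real (x n) + 2 * (Complex (1 / 2) t)) *
      cnj ((of_real (x n) + Complex (1 / 2) t) * (of_real (x (n + 1)) + Complex (1 / 2) t))"
    using structure_constants by blast
  obtain \<phi> where \<phi>: "\<And>n. cmod (\<phi> n) = 1"
    "\<And>n. \<phi> n * F 1 n = \<phi> (n + 1) * (of_real (x n) + Complex (1 / 2) t)"
    "\<And>n. \<phi> n * F 2 n = \<phi> (n + 2) * (of_real (x n) + 2 * Complex (1 / 2) t)"
    using phases_exist[OF P1 P2 tr] by blast
  have \<phi>0: "\<phi> n \<noteq> 0" for n
    using \<phi>(1)[of n] by auto
  define F' where "F' m n = \<phi> n * F m n / \<phi> (n + m)" for m n
  define G' where "G' m n = \<phi> n * G m n / \<phi> (n + m)" for m n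
  interpret u: unitary_hv_coeffs F' G' a c w z \<kappa> e
    unfolding F'_def G'_def using \<phi>(1) by (rule unitary_gauge)
  have "F' 1 n = of_real (u.x n) + Complex (1 / 2) t"
    "F' 2 n = of_real (u.x n) + 2 * Complex (1 / 2) t" for n
    using \<phi>0 \<phi>(2)[of n] \<phi>(3)[of n] by (simp_all add: F'_def u.x_def x_def)
  then interpret n: normalized_hv_coeffs F' G' a c w z \<kappa> e t "Complex (1 / 2) t"
    by unfold_locales (simp_all add: u.F_eqI)
  show thesis
  proof (rule that[OF \<phi>0 _ _ z n.w_eq_0 G1_norm_constant(1)])
    show "\<phi> n * F m n = \<phi> (n + m) * (of_real a + of_int n + of_int m * Complex (1 / 2) t)" for m n
      using n.F_eq[of m n] \<phi>0[of "n + m"] by (simp add: F'_def u.x_def field_simps)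
    show "\<phi> n * G m n = \<phi> (n + m) * c" for m n
      using n.G_eq[of m n] \<phi>0[of "n + m"] by (simp add: G'_def field_simps)
  qed
qed

section \<open>Modules with a weight basis\<close>

fun hv_degree :: "hv_basis \<Rightarrow> int" where
  "hv_degree (Lb m) = m"
| "hv_degree (Ib m) = m"
| "hv_degree _ = 0"

lemma b_elt_in_hv_graded: "b_elt i \<in> hv_graded (hv_degree i)"
  by (cases i) (auto simp: hv_graded_def hv_cartan_def intro!: fs.span_base)

locale hv_weight_basis = lie_module fscale hv_br sv act
  for sv :: "complex \<Rightarrow> 'v::ab_group_add \<Rightarrow> 'v" and act +
  fixes v :: "int \<Rightarrow> 'v" and K :: "hv_basis \<Rightarrow> int \<Rightarrow> complex"
  assumes inj_v: "inj v"
    and indep_v: "\<not> V.dependent (range v)"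
    and span_v: "V.span (range v) = UNIV"
    and act_v: "act (b_elt i) (v n) = sv (K i n) (v (n + hv_degree i))"
begin

lemma act_linear:
  "act (g + g') u = act g u + act g' u" "act (fscale k g) u = sv k (act g u)"
  "act (- g) u = - act g u" "act 0 u = 0"
  "act g (u + u') = act g u + act g u'" "act g (sv k u) = sv k (act g u)" "act g 0 = 0"
proof -
  interpret l: Vector_Spaces.linear fscale sv "\<lambda>g. act g u" by (rule act_linear_left)
  interpret r: Vector_Spaces.linear sv sv "act g" by (rule act_linear_right)
  show "act (g + g') u = act g u + act g' u" "act (fscale k g) u = sv k (act g u)"
    "act (- g) u = - act g u" "act 0 u = 0"
    by (fact l.add l.scale l.neg l.zero)+
  show "act g (u + u') = act g u + act g u'" "act g (sv k u) = sv k (act g u)" "act g 0 = 0"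
    by (fact r.add r.scale r.zero)+
qed

lemma v_nonzero: "v n \<noteq> 0"
  using indep_v V.dependent_zero by (metis rangeI)

lemma sv_v_cancel: "sv k (v n) = sv l (v n) \<longleftrightarrow> k = l"
  using v_nonzero[of n] by (simp add: V.scale_cancel_right)

lemma bracket_coeffs:
  "act (hv_br_basis i j) (v k) =
    sv (K i (k + hv_degree j) * K j k - K j (k + hv_degree i) * K i k) (v (k + hv_degree i + hv_degree j))"
  using act_br[of "b_elt i" "b_elt j" "v k"]
  by (simp add: hv_br_basis_eq act_v act_linear V.scale_left_diff_distrib mult.commute add_ac)

text \<open>The vectors indexed by \<open>S\<close> span a submodule. This serves as a propagation
  principle: a property holding at one index and passed along nonzero coefficients holds at all
  indices.\<close>

lemma irreducible_connected:
  assumes irr: "irreducible_module sv act"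
    and S: "S \<noteq> {}" "\<And>n i. n \<in> S \<Longrightarrow> K i n \<noteq> 0 \<Longrightarrow> n + hv_degree i \<in> S"
  shows "S = UNIV"
proof -
  let ?W = "V.span (v ` S)"
  have "act g u \<in> ?W" if "u \<in> ?W" for g u
    using that
  proof (induction u rule: V.span_induct_alt)
    case (step k u u')
    then obtain n where n: "n \<in> S" "u = v n" by blast
    have "act g (v n) \<in> ?W"
    proof (induction g rule: basis_induct)
      case (single i)
      have "K i n = 0 \<or> v (n + hv_degree i) \<in> ?W"
        using S(2)[OF n(1), of i] by (auto intro: V.span_base)
      then show ?case
        by (auto simp: act_v intro: V.span_scale V.span_zero)
    qed (auto simp: act_linear intro: V.span_zero V.span_add V.span_scale)
    with step n show ?case
      by (auto simp: act_linear intro: V.span_add V.span_scale)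
  qed (auto simp: act_linear intro: V.span_zero)
  then have "submodule sv act ?W"
    by (simp add: submodule_def V.subspace_span)
  moreover obtain n where "n \<in> S" using S(1) by blast
  then have "?W \<noteq> {0}"
    using v_nonzero[of n] V.span_base[of "v n" "v ` S"] by blast
  ultimately have W: "?W = UNIV"
    using irr unfolding irreducible_module_def by blast
  have "m \<in> S" for m
  proof (rule ccontr)
    assume "m \<notin> S"
    then have "v ` S \<subseteq> range v - {v m}"
      using inj_v by (auto dest: injD)
    then have "v m \<in> V.span (range v - {v m})"
      using V.span_mono[of "v ` S" "range v - {v m}"] W by blast
    with indep_v show False
      unfolding V.dependent_def by blast
  qed
  then show ?thesis by blast
qed

text \<open>The adjoint action of \<open>Lb 0\<close> multiplies a basis element by its degree, so a
  nonzero coefficient shifts the eigenvalue by exactly that degree.\<close>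

lemma L0_eigenvalue:
  assumes irr: "irreducible_module sv act"
  shows "K (Lb 0) n = K (Lb 0) 0 + of_int n"
proof -
  have 0: "K (Lb 0) (k + hv_degree i) = K (Lb 0) k + of_int (hv_degree i)" if "K i k \<noteq> 0" for k i
  proof -
    have "act (hv_br_basis (Lb 0) i) (v k) = sv (of_int (hv_degree i) * K i k) (v (k + hv_degree i))"
      by (cases i) (simp_all add: act_linear act_v)
    then have "K (Lb 0) (k + hv_degree i) * K i k - K i k * K (Lb 0) k = of_int (hv_degree i) * K i k"
      unfolding bracket_coeffs by (simp add: sv_v_cancel v_nonzero)
    then have "(K (Lb 0) (k + hv_degree i) - K (Lb 0) k) * K i k = of_int (hv_degree i) * K i k"
      by (simp add: algebra_simps)
    with that show ?thesis by (simp add: diff_eq_eq add.commute)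
  qed
  have "{n. K (Lb 0) n = K (Lb 0) 0 + of_int n} = UNIV"
  proof (rule irreducible_connected[OF irr])
    have "0 \<in> {n. K (Lb 0) n = K (Lb 0) 0 + of_int n}" by simp
    then show "{n. K (Lb 0) n = K (Lb 0) 0 + of_int n} \<noteq> {}" by blast
  qed (simp add: 0 add_ac)
  then show ?thesis by blast
qed

text \<open>An analogue of Schur's lemma. \<open>Ib 0\<close> is itself central: in its bracket with
  \<open>Lb m\<close>, the factor \<open>n\<close> and, at \<open>m = 0\<close>, the cocycle
  \<open>m^2 - m\<close> both vanish.\<close>

lemma central_scalar:
  assumes irr: "irreducible_module sv act" and j: "j \<in> {Ib 0, C_L, C_I, C_LI}"
  shows "K j n = K j 0"
proof -
  have 0: "K j (k + hv_degree i) = K j k" if "K i k \<noteq> 0" for k i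
  proof -
    have "hv_br_basis i j = 0" and j0: "hv_degree j = 0"
      using j by (cases i; auto)+
    then have "sv (K i k * K j k - K j (k + hv_degree i) * K i k) (v (k + hv_degree i)) = sv 0 (v (k + hv_degree i))"
      using bracket_coeffs[of i j k] by (simp add: act_linear)
    with that show ?thesis
      unfolding sv_v_cancel by simp
  qed
  have "{n. K j n = K j 0} = UNIV"
    by (rule irreducible_connected[OF irr]) (auto simp: 0)
  then show ?thesis by blast
qed

lemma coeff_relations:
  assumes irr: "irreducible_module sv act"
  shows "hv_coeffs (\<lambda>m. K (Lb m)) (\<lambda>m. K (Ib m)) (K (Lb 0) 0) (K (Ib 0) 0) (K C_LI 0) (K C_L 0) (K C_I 0)"
proof
  fix m n k :: int
  have C: "K j k = K j 0" if "j \<in> {C_L, C_I, C_LI}" for j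
    using that by (intro central_scalar[OF irr]) auto
  have act_if: "act (if m + n = 0 then fscale u (b_elt j) else 0) (v k) =
      sv (if m + n = 0 then u * K j 0 else 0) (v (k + m + n))"
    if "j \<in> {C_L, C_I, C_LI}" for u j
  proof (cases "m + n = 0")
    case True
    then have km: "k + m + n = k" by simp
    show ?thesis
      unfolding km using True that by (auto simp: act_linear act_v C)
  qed (simp add: act_linear)
  show "K (Lb m) (k + n) * K (Lb n) k - K (Lb n) (k + m) * K (Lb m) k =
       of_int (n - m) * K (Lb (m + n)) k + (if m + n = 0 then (of_int m ^ 3 - of_int m) / 12 * K C_L 0 else 0)"
    using bracket_coeffs[of "Lb m" "Lb n" k]
    by (simp only: hv_br_basis.simps act_linear act_if act_v hv_degree.simps V.scale_scale
        V.scale_left_distrib[symmetric] sv_v_cancel insert_iff simp_thms add.assoc[symmetric])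
  show "K (Lb m) (k + n) * K (Ib n) k - K (Ib n) (k + m) * K (Lb m) k =
       of_int n * K (Ib (m + n)) k + (if m + n = 0 then ((of_int m)\<^sup>2 - of_int m) * K C_LI 0 else 0)"
    using bracket_coeffs[of "Lb m" "Ib n" k]
    by (simp only: hv_br_basis.simps act_linear act_if act_v hv_degree.simps V.scale_scale
        V.scale_left_distrib[symmetric] sv_v_cancel insert_iff simp_thms add.assoc[symmetric])
  show "K (Ib m) (k + n) * K (Ib n) k - K (Ib n) (k + m) * K (Ib m) k =
       (if m + n = 0 then of_int n * K C_I 0 else 0)"
    using bracket_coeffs[of "Ib m" "Ib n" k]
    by (simp only: hv_br_basis.simps act_linear act_if act_v hv_degree.simps V.scale_scale
        V.scale_left_distrib[symmetric] sv_v_cancel insert_iff simp_thms add.assoc[symmetric])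
  show "K (Lb 0) k = K (Lb 0) 0 + of_int k"
    by (rule L0_eigenvalue[OF irr])
  show "K (Ib 0) k = K (Ib 0) 0"
    by (intro central_scalar[OF irr]) auto
qed

text \<open>The isomorphism sends \<open>\<psi> n\<close> times \<open>v n\<close> to the
  \<open>n\<close>-th standard basis vector; the hypotheses are its equivariance on basis
  elements.\<close>

lemma isomorphic_A:
  assumes \<psi>: "\<And>n. \<psi> n \<noteq> 0"
    and L: "\<And>m n. \<psi> n * K (Lb m) n = \<psi> (n + m) * (a + of_int n + of_int m * b)"
    and I: "\<And>m n. \<psi> n * K (Ib m) n = \<psi> (n + m) * c"
    and C: "\<And>n. K C_L n = 0" "\<And>n. K C_I n = 0" "\<And>n. K C_LI n = 0"
  shows "isomorphic_modules sv act fscale (A_act a b c)"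
proof -
  interpret vp: vector_space_pair sv fscale ..
  interpret A: lie_module fscale hv_br fscale "A_act a b c"
    by (rule lie_module_A)
  obtain f where f: "Vector_Spaces.linear sv fscale f"
    and fB: "\<forall>u\<in>range v. f u = fscale (inverse (\<psi> (inv v u))) (b_elt (inv v u))"
    using vp.linear_independent_extend[of "range v" "\<lambda>u. fscale (inverse (\<psi> (inv v u))) (b_elt (inv v u))"]
      indep_v by blast
  have fv: "f (v n) = fscale (inverse (\<psi> n)) (b_elt n)" for n
    using fB inj_v by simp
  interpret f: Vector_Spaces.linear sv fscale f by (rule f)
  have A_lin: "A_act a b c (fscale k g + g') y = fscale k (A_act a b c g y) + A_act a b c g' y"
    "A_act a b c g (fscale k y + y') = fscale k (A_act a b c g y) + A_act a b c g y'"
    "A_act a b c 0 y = 0" "A_act a b c g 0 = 0" for k g g' y y'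
    by (simp_all add: A_act_def ext_linear)
  have basis: "f (act (b_elt i) (v n)) = A_act a b c (b_elt i) (f (v n))" for i n
  proof -
    have i: "inverse (\<psi> (n + m)) * k = inverse (\<psi> n) * l" if "\<psi> n * k = \<psi> (n + m) * l" for m k l
      using that \<psi>[of n] \<psi>[of "n + m"] by (simp add: field_simps)
    show ?thesis
      using i[OF L] i[OF I]
      by (cases i) (simp_all add: act_v f.scale fv A_act_def fscale_single ext_linear C mult.commute add.commute)
  qed
  have "f (act g (v n)) = A_act a b c g (f (v n))" for g n
    by (induction g rule: basis_induct) (simp_all add: act_linear f.add f.scale f.zero A_lin basis)
  moreover have u: "u \<in> V.span (range v)" for u
    using span_v by simp
  ultimately have equivariant: "f (act g u) = A_act a b c g (f u)" for g u
    by (induction u rule: V.span_induct_alt[OF u])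
      (auto simp: act_linear f.add f.scale f.zero A_lin)
  have "inj f"
    unfolding f.inj_iff_eq_0
  proof (intro allI impI)
    fix u assume "f u = 0"
    from u[of u] obtain T r where T: "finite T" "T \<subseteq> range v" and u: "u = (\<Sum>y\<in>T. sv (r y) y)"
      unfolding V.span_explicit by auto
    have "r (v n) = 0" if "v n \<in> T" for n
    proof -
      have "Poly_Mapping.lookup (f y) n = (if y = v n then inverse (\<psi> n) else 0)" if "y \<in> T" for y
        using that T(2) inj_v by (auto simp: fv lookup_single when_def inj_eq)
      then have "Poly_Mapping.lookup (f u) n = (\<Sum>y\<in>T. if y = v n then r y * inverse (\<psi> n) else 0)"
        unfolding u f.sum lookup_sum f.scale by (intro sum.cong) auto
      also have "\<dots> = r (v n) * inverse (\<psi> n)"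
        using T(1) that by (simp add: sum.delta)
      finally show ?thesis
        using \<open>f u = 0\<close> \<psi>[of n] by simp
    qed
    with T(2) show "u = 0"
      unfolding u by (intro sum.neutral) auto
  qed
  moreover have "y \<in> range f" for y
  proof (induction y rule: basis_induct)
    case zero
    then show ?case using f.zero by (metis rangeI)
  next
    case (single n)
    have "f (sv (\<psi> n) (v n)) = b_elt n"
      by (simp add: f.scale fv \<psi>)
    then show ?case by (metis rangeI)
  next
    case (add k y y')
    then obtain u u' where "y = f u" "y' = f u'" by blast
    then have "fscale k y + y' = f (sv k u + u')"
      by (simp add: f.add f.scale)
    then show ?case by blast
  qed
  ultimately have "bij f"
    by (auto simp: bij_def)
  with f equivariant show ?thesis
    unfolding isomorphic_modules_def by blast
qed

end

section \<open>Consequences of the contravariant form\<close>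

lemma theta_plus_b_elt: "theta_plus \<alpha> \<gamma> (b_elt i) = theta_plus_basis \<alpha> \<gamma> i"
  by (simp add: theta_plus_def)

locale unitary_hv_weight_basis = hv_weight_basis sv act v K
  for sv :: "complex \<Rightarrow> 'v::ab_group_add \<Rightarrow> 'v" and act v K +
  fixes H :: "'v \<Rightarrow> 'v \<Rightarrow> complex" and \<alpha> \<gamma> :: real
  assumes \<alpha>_pos: "\<alpha> > 0"
    and irr: "irreducible_module sv act"
    and pos_def: "pos_def_hermitian_form sv H"
    and contravariant: "H (act g u) u' = H u (act (theta_plus \<alpha> \<gamma> g) u')"
begin

lemma H_scale: "H (sv k u) u' = k * H u u'" "H u (sv k u') = cnj k * H u u'" "H 0 u = 0" "H u 0 = 0"
proof -
  have herm: "H u u' = cnj (H u' u)" for u u'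
    using pos_def unfolding pos_def_hermitian_form_def by blast
  have l: "H (sv k u) u' = k * H u u'" "H 0 u = 0" for k u u'
  proof -
    interpret l: Vector_Spaces.linear sv "(*)" "\<lambda>u. H u u'" for u'
      using pos_def unfolding pos_def_hermitian_form_def by blast
    show "H (sv k u) u' = k * H u u'" "H 0 u = 0"
      by (fact l.scale l.zero)+
  qed
  show "H (sv k u) u' = k * H u u'" "H 0 u = 0"
    by (fact l)+
  show "H u (sv k u') = cnj k * H u u'"
    by (subst (1 2) herm) (simp add: l)
  show "H u 0 = 0"
    by (subst herm) (simp add: l)
qed

lemma H_add_right: "H u (u1 + u2) = H u u1 + H u u2"
proof -
  have herm: "H u u' = cnj (H u' u)" for u u'
    using pos_def unfolding pos_def_hermitian_form_def by blast
  interpret l: Vector_Spaces.linear sv "(*)" "\<lambda>u'. H u' u"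
    using pos_def unfolding pos_def_hermitian_form_def by blast
  show ?thesis
    by (subst (1 2 3) herm) (simp add: l.add)
qed

definition N :: "int \<Rightarrow> real" where "N n = Re (H (v n) (v n))"

lemma N_pos: "N n > 0" and H_v: "H (v n) (v n) = of_real (N n)"
proof -
  have "H (v n) (v n) \<in> \<real>" "0 < Re (H (v n) (v n))"
    using pos_def v_nonzero[of n] unfolding pos_def_hermitian_form_def by blast+
  then show "N n > 0" "H (v n) (v n) = of_real (N n)"
    by (simp_all add: N_def)
qed

definition a where "a = Re (K (Lb 0) 0)"

text \<open>\<open>Lb 0\<close> is fixed by \<open>theta_plus\<close>, hence acts as a self-adjoint
  operator.\<close>

lemma L0_real: "K (Lb 0) n = of_real (a + of_int n)"
proof -
  have "K (Lb 0) n * of_real (N n) = cnj (K (Lb 0) n) * of_real (N n)"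
    using contravariant[of "b_elt (Lb 0)" "v n" "v n"]
    by (simp add: theta_plus_b_elt act_v H_scale H_v)
  then have "cnj (K (Lb 0) n) = K (Lb 0) n"
    using N_pos[of n] by simp
  then have "Im (K (Lb 0) n) = 0"
    by (simp add: complex_eq_iff)
  then show ?thesis
    using L0_eigenvalue[OF irr, of n] by (simp add: complex_eq_iff a_def)
qed

text \<open>Pairing the image of \<open>v n\<close> with the target vector \<open>v (n + m)\<close>
  leaves only squared norms of basis vectors.\<close>

lemma L_adjoint: "K (Lb m) n * of_real (N (n + m)) =
    of_real (\<alpha> powi m) * cnj (K (Lb (- m)) (n + m)) * of_real (N n)"
  using contravariant[of "b_elt (Lb m)" "v n" "v (n + m)"]
  by (simp add: theta_plus_b_elt act_linear act_v H_scale H_v)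

lemma I_adjoint:
  assumes "m \<noteq> 0"
  shows "K (Ib m) n * of_real (N (n + m)) =
    of_real (\<alpha> powi m) * cnj (exp (\<i> * of_real \<gamma>)) * cnj (K (Ib (- m)) (n + m)) * of_real (N n)"
  using contravariant[of "b_elt (Ib m)" "v n" "v (n + m)"] assms
  by (simp add: theta_plus_b_elt act_linear act_v H_scale H_v)

lemma I0_adjoint: "K (Ib 0) 0 = cnj (exp (\<i> * of_real \<gamma>)) * cnj (K (Ib 0) 0 + 2 * K C_LI 0)"
proof -
  have "K (Ib 0) 0 * of_real (N 0) = cnj (exp (\<i> * of_real \<gamma>)) * cnj (K (Ib 0) 0 + 2 * K C_LI 0) * of_real (N 0)"
    using contravariant[of "b_elt (Ib 0)" "v 0" "v 0"]
    by (simp add: theta_plus_b_elt act_linear act_v H_scale H_v H_add_right algebra_simps)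
  then show ?thesis
    using N_pos[of 0] by simp
qed

lemma isomorphic_unitary_A:
  obtains t :: real and c where "c = cnj c * exp (- \<i> * of_real \<gamma>)"
    "isomorphic_modules sv act fscale (A_act (of_real a) (1 / 2 + \<i> * of_real t) c)"
proof -
  define e where "e = exp (\<i> * complex_of_real \<gamma>)"
  have cnj_e: "cnj e = exp (- \<i> * of_real \<gamma>)"
    using cis_cnj[of \<gamma>] by (simp add: e_def cis_conv_exp)
  have e: "cnj e * e = 1"
    unfolding cnj_e unfolding e_def by (simp flip: exp_add)
  \<comment> \<open>The vector \<open>v n\<close> scaled by \<open>q n\<close> has squared norm
    \<open>\<alpha> powi n\<close>, the normalisation that removes \<open>\<alpha>\<close> from the
    adjointness relations; \<open>\<alpha> > 0\<close> makes the square root positive.\<close>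
  define q where "q n = sqrt (\<alpha> powi n / N n)" for n
  define r where "r n = complex_of_real (q n)" for n
  have q_pos: "q n > 0" for n
    using \<alpha>_pos N_pos by (simp add: q_def)
  then have r_nz: "r n \<noteq> 0" for n
    by (metis less_irrefl of_real_eq_0_iff r_def)
  have q2: "(q n)\<^sup>2 = \<alpha> powi n / N n" for n
    using \<alpha>_pos N_pos[of n] by (simp add: q_def)
  have rq: "r n * r n = of_real (\<alpha> powi n / N n)" for n
    unfolding q2[symmetric] by (simp add: r_def power2_eq_square)
  have adj: "r (n + m) * y / r n = cnj (r n * x / r (n + m))"
    if "x * of_real (N (n + m)) = of_real (\<alpha> powi m) * cnj y * of_real (N n)" for m n x y
  proof -
    have A: "complex_of_real (\<alpha> powi m) \<noteq> 0" "complex_of_real (\<alpha> powi n) \<noteq> 0"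
        "complex_of_real (N n) \<noteq> 0" "complex_of_real (N (n + m)) \<noteq> 0"
      using \<alpha>_pos N_pos[of n] N_pos[of "n + m"] by auto
    have "r n * r n * x = r (n + m) * r (n + m) * cnj y"
      using that A \<alpha>_pos unfolding rq by (simp add: power_int_add field_simps)
    then have "cnj (r n * r n * x) = cnj (r (n + m) * r (n + m) * cnj y)"
      by simp
    then show ?thesis
      using r_nz[of n] r_nz[of "n + m"] by (simp add: r_def field_simps)
  qed
  have aK: "K (Lb 0) 0 = of_real a"
    using L0_real[of 0] by simp
  interpret k: hv_coeffs "\<lambda>m. K (Lb m)" "\<lambda>m. K (Ib m)" "of_real a" "K (Ib 0) 0" "K C_LI 0" "K C_L 0" "K C_I 0"
    using coeff_relations[OF irr] unfolding aK .
  interpret g: hv_coeffs "\<lambda>m n. r n * K (Lb m) n / r (n + m)" "\<lambda>m n. r n * K (Ib m) n / r (n + m)"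
    "of_real a" "K (Ib 0) 0" "K C_LI 0" "K C_L 0" "K C_I 0"
    by (rule k.gauge) (rule r_nz)
  interpret u: unitary_hv_coeffs "\<lambda>m n. r n * K (Lb m) n / r (n + m)" "\<lambda>m n. r n * K (Ib m) n / r (n + m)"
    a "K (Ib 0) 0" "K C_LI 0" "K C_L 0" "K C_I 0" e
  proof
    fix m n
    show "r (n + m) * K (Lb (- m)) (n + m) / r (n + m + - m) = cnj (r n * K (Lb m) n / r (n + m))"
      using adj[OF L_adjoint] by simp
    show "cnj (r n * K (Ib m) n / r (n + m)) = e * (r (n + m) * K (Ib (- m)) (n + m) / r (n + m + - m))"
      if "m \<noteq> 0"
      using adj[of "K (Ib m) n" n m "e * K (Ib (- m)) (n + m)"] I_adjoint[OF that, of n]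
      by (simp add: e_def mult_ac)
    show "cnj (K (Ib 0) 0) = e * (K (Ib 0) 0 + 2 * K C_LI 0)"
      using arg_cong[OF I0_adjoint, of cnj] by (simp add: e_def)
  qed (rule e)
  obtain t :: real and \<phi> :: "int \<Rightarrow> complex" where \<phi>:
    "\<And>n. \<phi> n \<noteq> 0"
    "\<And>m n. \<phi> n * (r n * K (Lb m) n / r (n + m)) =
       \<phi> (n + m) * (of_real a + of_int n + of_int m * Complex (1 / 2) t)"
    "\<And>m n. \<phi> n * (r n * K (Ib m) n / r (n + m)) = \<phi> (n + m) * K (Ib 0) 0"
    "K C_L 0 = 0" "K C_LI 0 = 0" "K C_I 0 = 0"
    by (rule u.intermediate_series_classification) (rule that)
  have b: "Complex (1 / 2) t = 1 / 2 + \<i> * of_real t"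
    by (simp add: complex_eq_iff)
  show thesis
  proof (rule that)
    show "K (Ib 0) 0 = cnj (K (Ib 0) 0) * exp (- \<i> * of_real \<gamma>)"
      using I0_adjoint \<phi>(5) unfolding cnj_e[symmetric] e_def[symmetric] by (simp add: mult.commute)
    show "isomorphic_modules sv act fscale (A_act (of_real a) (1 / 2 + \<i> * of_real t) (K (Ib 0) 0))"
    proof (rule isomorphic_A)
      show "\<phi> n * r n \<noteq> 0" for n
        using \<phi>(1) r_nz by simp
      show "\<phi> n * r n * K (Lb m) n = \<phi> (n + m) * r (n + m) * (of_real a + of_int n + of_int m * (1 / 2 + \<i> * of_real t))"
        for m n
      proof -
        have "\<phi> n * r n * K (Lb m) n = \<phi> n * (r n * K (Lb m) n / r (n + m)) * r (n + m)"
          using r_nz[of "n + m"] by simp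
        then show ?thesis
          unfolding \<phi>(2) b by (simp add: mult_ac)
      qed
      show "\<phi> n * r n * K (Ib m) n = \<phi> (n + m) * r (n + m) * K (Ib 0) 0" for m n
      proof -
        have "\<phi> n * r n * K (Ib m) n = \<phi> n * (r n * K (Ib m) n / r (n + m)) * r (n + m)"
          using r_nz[of "n + m"] by simp
        then show ?thesis
          unfolding \<phi>(3) by (simp add: mult_ac)
      qed
      show "K C_L n = 0" "K C_I n = 0" "K C_LI n = 0" for n
        using central_scalar[OF irr, of C_L n] central_scalar[OF irr, of C_I n]
          central_scalar[OF irr, of C_LI n] \<phi>(4-6) by auto
    qed
  qed
qed

end

theorem theorem3p4:
  fixes \<alpha> \<gamma> :: real
    and sv :: "complex \<Rightarrow> 'v::ab_group_add \<Rightarrow> 'v"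
    and act :: "hv \<Rightarrow> 'v \<Rightarrow> 'v"
  assumes "\<alpha> > 0"
    and "lie_module fscale hv_br sv act"
    and "harish_chandra_module fscale hv_cartan sv act"
    and "intermediate_series sv act"
    and "irreducible_module sv act"
    and "unitary_module (theta_plus \<alpha> \<gamma>) sv act"
  shows "\<exists>(a::real) b c.
           b \<in> {1/2 + \<i> * complex_of_real t | t. True} \<and>
           c = cnj c * exp (- \<i> * complex_of_real \<gamma>) \<and>
           isomorphic_modules sv act fscale (A_act (complex_of_real a) b c)"
proof -
  interpret lie_module fscale hv_br sv act by (rule assms(2))
  obtain v :: "int \<Rightarrow> 'v" where v: "inj v" "\<not> V.dependent (range v)" "V.span (range v) = UNIV"
    and deg: "\<forall>m n. \<forall>x\<in>hv_graded m. act x (v n) \<in> V.span {v (m + n)}"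
    using assms(4) unfolding intermediate_series_def by (elim conjE exE) (rule that)
  \<comment> \<open>Basis elements are homogeneous, so each sends \<open>v n\<close> to a multiple
    of a single basis vector; these multiples form \<open>K\<close>.\<close>
  have "\<exists>k. act (b_elt i) (v n) = sv k (v (n + hv_degree i))" for i n
  proof -
    have "act (b_elt i) (v n) \<in> V.span {v (hv_degree i + n)}"
      using deg b_elt_in_hv_graded by blast
    then show ?thesis
      unfolding V.span_singleton by (auto simp: add.commute)
  qed
  then obtain K where K: "\<And>i n. act (b_elt i) (v n) = sv (K i n) (v (n + hv_degree i))"
    by metis
  obtain H where H: "pos_def_hermitian_form sv H"
    "\<And>x u u'. H (act x u) u' = H u (act (theta_plus \<alpha> \<gamma> x) u')"
    using assms(6) unfolding unitary_module_def by blast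
  interpret unitary_hv_weight_basis sv act v K H \<alpha> \<gamma>
    proof
  qed (fact assms v K H)+
  obtain t :: real and c where "c = cnj c * exp (- \<i> * complex_of_real \<gamma>)"
    "isomorphic_modules sv act fscale (A_act (of_real a) (1 / 2 + \<i> * of_real t) c)"
    by (rule isomorphic_unitary_A)
  then show ?thesis
    by (intro exI[of _ a] exI[of _ "1 / 2 + \<i> * of_real t"] exI[of _ c]) blast
qed

end
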